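(* Assume (h1)–(h5) (stated in the context). Given $\zeta\in C^+\setminus\{0\}$ and $(t,x)\in[0,T)\times\mathbb{R}^n$, and considering $\mathcal{L}_t(t,\cdot):\mathbb{R}^n\to\mathcal{F}(\mathbb{R}^d,C)$, the value function $U(t,x)$ is a solution of the equation $$ U_{t,\zeta}(t,x)=\mathcal{L}_t^*(t,-\nabla u_\zeta(t,x),\zeta)+w(t,x,\zeta), $$ where $\nabla u_\zeta(t,x)=d_t(T)\nabla g_\zeta(Y_{t,x,\zeta}(T))$ and $$ w(t,x,\zeta)=\int_t^T\frac{\partial d_t(s)}{\partial t}L\bigl(\dot Y_{t,x,\zeta}(s)\bigr)ds+\frac{\partial d_t(T)}{\partial t}g(Y_{t,x,\zeta}(T))\in\mathbb{R}^d . $$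
   Context: Let $C\subset\mathbb{R}^d$ be a closed convex cone with nonempty interior and $C^+=\{\zeta\in\mathbb{R}^d : \zeta\cdot z\ge 0\ \forall z\in C\}$. For $\zeta\in C^+\setminus\{0\}$, $H^+(\zeta)=\{z\in\mathbb{R}^d:\zeta\cdot z\ge0\}$. $A+B$ is the Minkowski sum (with $A+\emptyset=\emptyset$), $A\oplus B=\mathrm{cl}(A+B)$; a vector added to a set is a translation. $\mathcal{F}(\mathbb{R}^d,C)=\{A\subseteq\mathbb{R}^d : A=A\oplus C\}$, ordered by $\supseteq$, is a complete lattice with $\inf\mathcal{A}=\mathrm{cl}\bigcup_{A\in\mathcal{A}}A$, $\sup\mathcal{A}=\bigcap_{A\in\mathcal{A}}A$. The $\zeta$-difference is $A-_\zeta B=\{z\in\mathbb{R}^d: z+B\subseteq A\oplus H^+(\zeta)\}$. Limits of sets: $\lim_{m\to\infty}A_m=\{z : \exists z_m\in A_m\ (m\in\mathbb{N}),\ z_m\to z\}$, and $\lim_{s\to s_*}A_s$ is the set equal to $\lim_mA_{s_m}$ for every sequence $s_m\to s_*$. For $\eta\in\mathbb{R}^n$, $\zeta\in C^+$: $S_{(\eta,\zeta)}(x)=\{z\in\mathbb{R}^d:\zeta\cdot z\ge\eta\cdot x\}$. The Fenchel conjugate of $f:\mathbb{R}^n\to\mathcal{F}(\mathbb{R}^d,C)$ is $f^*(\eta,\zeta)=\sup_{x\in\mathbb{R}^n}\bigl(S_{(\eta,\zeta)}(x)-_\zeta f(x)\bigr)$ for $\eta\in\mathbb{R}^n$, $\zeta\in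 C^+\setminus\{0\}$; $\mathcal{L}_t^*(s,\eta,\zeta)$ denotes the conjugate of $\mathcal{L}_t(s,\cdot)$ at $(\eta,\zeta)$. Let $T>0$, $L,g:\mathbb{R}^n\to\mathbb{R}^d$, and let $d_t(s)>0$ ($t\in[0,T]$, $s\in[t,T]$) be a discount factor. For $\zeta\in C^+\setminus\{0\}$ put $L_\zeta(w)=L(w)\cdot\zeta$, $g_\zeta(w)=g(w)\cdot\zeta$. Let $B^+$ be a base of $C^+$ (each $\zeta\in C^+\setminus\{0\}$ is uniquely $\lambda\xi$ with $\lambda>0$, $\xi\in B^+$). Hypotheses: (h1) for all $\zeta\in B^+$, $L_\zeta$ is $C^2$, strictly convex and coercive: $\lim_{|w|\to\infty}L_\zeta(w)/|w|=+\infty$ (so $\nabla L_\zeta$ is a homeomorphism of $\mathbb{R}^n$ for every $\zeta\in C^+\setminus\{0\}$); (h2) for all $\zeta\in B^+$, $g_\zeta$ is globally Lipschitz in $\mathbb{R}^n$; (h3) for any $t\in[0,T]$, $d_t:[t,T]\to(a,1]$, with $a>0$, is continuous, and $d_t(t)=1$; (h4) the discount factor is of class $C^1$ in $t$; (h5) for all $\zeta\in B^+$, $g_\zeta$ is $C^2$ and convex. $\mathcal{L}_t(s,w)=d_t(s)L(w)+C$ for $s\in[t,T]$, $w\in\mathbb{R}^n$. For $y\in W^{1,1}([t,T],\mathbb{R}^n)$: $I_t(y)=\int_t^Td_t(s)L(\dot y(s))\,ds+d_t(T)g(y(T))$, $I_{t,\zeta}(y)=I_t(y)\cdot\zeta$,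 $J_t(y)=\int_t^T\mathcal{L}_t(s,\dot y(s))\,ds+d_t(T)g(y(T))$ (Aumann integral; $\int_t^tF\,ds=C$). $A(t,x)=\{y\in W^{1,1}([t,T],\mathbb{R}^n): y(t)=x\}$, and $U(t,x)=\inf_{y\in A(t,x)}J_t(y)$ in $\mathcal{F}(\mathbb{R}^d,C)$. $Y_{t,x,p,\zeta}(s)=x+\int_t^s(\nabla L_\zeta)^{-1}\bigl(p/d_t(r)\bigr)dr$, and $Y_{t,x,\zeta}=Y_{t,x,p(t,x,\zeta),\zeta}$, where $p(t,x,\zeta)\in\mathbb{R}^n$ is a point with $I_{t,\zeta}(Y_{t,x,p(t,x,\zeta),\zeta})=\inf_{p\in\mathbb{R}^n}I_{t,\zeta}(Y_{t,x,p,\zeta})$ (such a point exists). The derivative of $U$ in $t$ is $$U_{t,\zeta}(t,x)=\lim_{s\to0^+}\frac1s\bigl[U(t+s,x)-_\zeta U(t,x)\bigr].$$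
   Formalization: (h4) is taken to mean that ∂d_t(s)/∂t is continuous jointly in (t,s), and the vector integrals of d_t(s)L(Ẏ_{t,x,q,ζ}(s)) are assumed to exist for all q; otherwise w or I_t may be undefined. *)

theory Defs
  imports "HOL-Analysis.Analysis"
begin

definition dual_cone :: "'a::real_inner set \<Rightarrow> 'a set" where
  "dual_cone C = {\<zeta>. \<forall>z\<in>C. 0 \<le> \<zeta> \<bullet> z}"

definition is_base :: "'a::real_vector set \<Rightarrow> 'a set \<Rightarrow> bool" where
  "is_base B K \<longleftrightarrow> B \<subseteq> K - {0} \<and>
     (\<forall>\<zeta>\<in>K - {0}. \<exists>!q::real \<times> 'a. 0 < fst q \<and> snd q \<in> B \<and> \<zeta> = fst q *\<^sub>R snd q)"

definition Hplus :: "'a::real_inner \<Rightarrow> 'a set" where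
  "Hplus \<zeta> = {z. 0 \<le> \<zeta> \<bullet> z}"

definition oplus :: "'a::real_normed_vector set \<Rightarrow> 'a set \<Rightarrow> 'a set" where
  "oplus A B = closure (A + B)"

definition zeta_diff :: "'a::real_inner \<Rightarrow> 'a set \<Rightarrow> 'a set \<Rightarrow> 'a set" where
  "zeta_diff \<zeta> A B = {z. (+) z ` B \<subseteq> oplus A (Hplus \<zeta>)}"

text \<open>Infimum and supremum in the complete lattice of all sets \<open>A = oplus A C\<close>, ordered by
  \<open>\<supseteq>\<close>; the order is reversed, so the infimum is a closed union.\<close>

definition lat_inf :: "'a::topological_space set set \<Rightarrow> 'a set" where
  "lat_inf \<A> = closure (\<Union>\<A>)"

definition lat_sup :: "'a set set \<Rightarrow> 'a set" where
  "lat_sup \<A> = \<Inter>\<A>"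

definition S_fun :: "'b::real_inner \<Rightarrow> 'a::real_inner \<Rightarrow> 'b \<Rightarrow> 'a set" where
  "S_fun \<eta> \<zeta> x = {z. \<zeta> \<bullet> z \<ge> \<eta> \<bullet> x}"

definition fenchel_conj ::
    "('b::real_inner \<Rightarrow> 'a::real_inner set) \<Rightarrow> 'b \<Rightarrow> 'a \<Rightarrow> 'a set" where
  "fenchel_conj f \<eta> \<zeta> = lat_sup (range (\<lambda>x. zeta_diff \<zeta> (S_fun \<eta> \<zeta> x) (f x)))"

definition seq_set_lim :: "(nat \<Rightarrow> 'a::topological_space set) \<Rightarrow> 'a set" where
  "seq_set_lim A = {z. \<exists>zs. (\<forall>m. zs m \<in> A m) \<and> zs \<longlonglongrightarrow> z}"

text \<open>Existence of the set limit \<open>lim A\<^sub>s\<close> as \<open>s\<close> tends to \<open>s0\<close> within \<open>S\<close>, with value \<open>M\<close>.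
  The set \<open>S\<close> is the parameter domain on which \<open>A\<^sub>s\<close> makes sense.\<close>

definition has_set_limit ::
    "(real \<Rightarrow> 'a::topological_space set) \<Rightarrow> 'a set \<Rightarrow> real \<Rightarrow> real set \<Rightarrow> bool" where
  "has_set_limit A M s0 S \<longleftrightarrow>
     (\<forall>\<sigma>::nat \<Rightarrow> real. (\<forall>m. \<sigma> m \<in> S) \<and> \<sigma> \<longlonglongrightarrow> s0 \<longrightarrow> seq_set_lim (\<lambda>m. A (\<sigma> m)) = M)"

definition grad :: "('b::real_inner \<Rightarrow> real) \<Rightarrow> 'b \<Rightarrow> 'b" where
  "grad f x = (THE D. GDERIV f x :> D)"

definition C2 :: "('b::real_inner \<Rightarrow> real) \<Rightarrow> bool" where
  "C2 f \<longleftrightarrow> (\<forall>x. \<exists>D. GDERIV f x :> D) \<and>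
     (\<exists>H :: 'b \<Rightarrow> 'b \<Rightarrow>\<^sub>L 'b. continuous_on UNIV H \<and>
        (\<forall>x. (grad f has_derivative blinfun_apply (H x)) (at x)))"

definition strictly_convex :: "('b::real_vector \<Rightarrow> real) \<Rightarrow> bool" where
  "strictly_convex f \<longleftrightarrow>
     (\<forall>x y u. x \<noteq> y \<and> 0 < u \<and> u < 1 \<longrightarrow>
        f ((1 - u) *\<^sub>R x + u *\<^sub>R y) < (1 - u) * f x + u * f y)"

definition coercive :: "('b::real_normed_vector \<Rightarrow> real) \<Rightarrow> bool" where
  "coercive f \<longleftrightarrow> filterlim (\<lambda>w. f w / norm w) at_top at_infinity"

text \<open>\<open>W\<^sup>1\<^sup>,\<^sup>1([a,b])\<close> consists of the (absolutely continuous) primitives of integrable functions;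
  the density, unique up to null sets, is the weak derivative. Values outside \<open>[a,b]\<close> are
  irrelevant.\<close>

definition has_weak_deriv ::
    "(real \<Rightarrow> 'b::euclidean_space) \<Rightarrow> (real \<Rightarrow> 'b) \<Rightarrow> real \<Rightarrow> real \<Rightarrow> bool" where
  "has_weak_deriv y v a b \<longleftrightarrow> set_integrable lebesgue {a..b} v \<and>
     (\<forall>s\<in>{a..b}. y s = y a + (LINT r:{a..s}|lebesgue. v r))"

definition W11 :: "real \<Rightarrow> real \<Rightarrow> (real \<Rightarrow> 'b::euclidean_space) set" where
  "W11 a b = {y. \<exists>v. has_weak_deriv y v a b}"

definition weak_deriv :: "real \<Rightarrow> real \<Rightarrow> (real \<Rightarrow> 'b::euclidean_space) \<Rightarrow> real \<Rightarrow> 'b" where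
  "weak_deriv a b y = (SOME v. has_weak_deriv y v a b)"

text \<open>The Aumann integral collects the integrals of all integrable selections; over a degenerate
  interval it is by convention the cone \<open>C\<close>, the neutral element of the lattice.\<close>

definition aumann_integral ::
    "'a::euclidean_space set \<Rightarrow> real \<Rightarrow> real \<Rightarrow> (real \<Rightarrow> 'a set) \<Rightarrow> 'a set" where
  "aumann_integral C a b F =
     (if a = b then C
      else {(LINT s:{a..b}|lebesgue. f s) | f.
              set_integrable lebesgue {a..b} f \<and> (AE s\<in>{a..b} in lebesgue. f s \<in> F s)})"

text \<open>In the following, \<open>d t s\<close> is the discount factor \<open>d\<^sub>t(s)\<close>.\<close>

definition running_cost ::
    "'a::euclidean_space set \<Rightarrow> ('b \<Rightarrow> 'a) \<Rightarrow> (real \<Rightarrow> real \<Rightarrow> real) \<Rightarrow> real \<Rightarrow> real \<Rightarrow> 'b \<Rightarrow> 'a set"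
  where "running_cost C L d t s w = (+) (d t s *\<^sub>R L w) ` C"

definition I_cost ::
    "('b::euclidean_space \<Rightarrow> 'a::euclidean_space) \<Rightarrow> ('b \<Rightarrow> 'a) \<Rightarrow> (real \<Rightarrow> real \<Rightarrow> real) \<Rightarrow>
      real \<Rightarrow> real \<Rightarrow> (real \<Rightarrow> 'b) \<Rightarrow> 'a" where
  "I_cost L g d T t y =
     (LINT s:{t..T}|lebesgue. d t s *\<^sub>R L (weak_deriv t T y s)) + d t T *\<^sub>R g (y T)"

definition I_scal ::
    "('b::euclidean_space \<Rightarrow> 'a::euclidean_space) \<Rightarrow> ('b \<Rightarrow> 'a) \<Rightarrow> (real \<Rightarrow> real \<Rightarrow> real) \<Rightarrow>
      real \<Rightarrow> real \<Rightarrow> 'a \<Rightarrow> (real \<Rightarrow> 'b) \<Rightarrow> real" where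
  "I_scal L g d T t \<zeta> y = I_cost L g d T t y \<bullet> \<zeta>"

definition J_cost ::
    "'a::euclidean_space set \<Rightarrow> ('b::euclidean_space \<Rightarrow> 'a) \<Rightarrow> ('b \<Rightarrow> 'a) \<Rightarrow>
      (real \<Rightarrow> real \<Rightarrow> real) \<Rightarrow> real \<Rightarrow> real \<Rightarrow> (real \<Rightarrow> 'b) \<Rightarrow> 'a set" where
  "J_cost C L g d T t y =
     (+) (d t T *\<^sub>R g (y T)) `
       aumann_integral C t T (\<lambda>s. running_cost C L d t s (weak_deriv t T y s))"

definition admissible :: "real \<Rightarrow> real \<Rightarrow> 'b::euclidean_space \<Rightarrow> (real \<Rightarrow> 'b) set" where
  "admissible T t x = {y \<in> W11 t T. y t = x}"

definition value_fun ::
    "'a::euclidean_space set \<Rightarrow> ('b::euclidean_space \<Rightarrow> 'a) \<Rightarrow> ('b \<Rightarrow> 'a) \<Rightarrow>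
      (real \<Rightarrow> real \<Rightarrow> real) \<Rightarrow> real \<Rightarrow> real \<Rightarrow> 'b \<Rightarrow> 'a set" where
  "value_fun C L g d T t x = lat_inf (J_cost C L g d T t ` admissible T t x)"

definition Y_path ::
    "('b::euclidean_space \<Rightarrow> 'a::euclidean_space) \<Rightarrow> (real \<Rightarrow> real \<Rightarrow> real) \<Rightarrow>
      real \<Rightarrow> 'b \<Rightarrow> 'b \<Rightarrow> 'a \<Rightarrow> real \<Rightarrow> 'b" where
  "Y_path L d t x p \<zeta> s =
     x + (LINT r:{t..s}|lebesgue. inv (grad (\<lambda>w. L w \<bullet> \<zeta>)) ((1 / d t r) *\<^sub>R p))"

text \<open>\<open>w(t,x,\<zeta>)\<close> for the path \<open>y = Y\<^bsub>t,x,\<zeta>\<^esub>\<close>; here \<open>d' t s\<close> is the partial derivative of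
  \<open>d\<^sub>t(s)\<close> with respect to \<open>t\<close>.\<close>

definition w_fun ::
    "('b::euclidean_space \<Rightarrow> 'a::euclidean_space) \<Rightarrow> ('b \<Rightarrow> 'a) \<Rightarrow> (real \<Rightarrow> real \<Rightarrow> real) \<Rightarrow>
      real \<Rightarrow> real \<Rightarrow> (real \<Rightarrow> 'b) \<Rightarrow> 'a" where
  "w_fun L g d' T t y =
     (LINT s:{t..T}|lebesgue. d' t s *\<^sub>R L (weak_deriv t T y s)) + d' t T *\<^sub>R g (y T)"

text \<open>The \<open>\<zeta>\<close>-derivative in time of \<open>U\<close> at \<open>(t,x)\<close> exists and equals \<open>M\<close>. As \<open>U\<close> lives on
  \<open>[0,T]\<close>, the increments \<open>s\<close> range over \<open>(0, T - t]\<close>.\<close>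

definition has_time_deriv ::
    "(real \<Rightarrow> 'b \<Rightarrow> 'a::real_inner set) \<Rightarrow> real \<Rightarrow> 'a \<Rightarrow> real \<Rightarrow> 'b \<Rightarrow> 'a set \<Rightarrow> bool" where
  "has_time_deriv U T \<zeta> t x M \<longleftrightarrow>
     has_set_limit (\<lambda>s. (*\<^sub>R) (1 / s) ` zeta_diff \<zeta> (U (t + s) x) (U t x)) M 0 {0<..T - t}"

end

theory Submission
  imports Defs
begin

text \<open>The \<open>\<zeta>\<close>-differences in the statement, and hence both sides of the equation, are half-spaces orthogonal
  to \<open>\<zeta>\<close>, so the equation is a scalar one. Write \<open>\<l>(w) = L(w) \<bullet> \<zeta>\<close>, \<open>\<gamma>(w) = g(w) \<bullet> \<zeta>\<close> and let \<open>v(\<tau>)\<close> be the infimum of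
  \<open>\<zeta> \<bullet> z\<close> over \<open>z \<in> U(\<tau>,x)\<close>. Adding \<open>H\<^sup>+(\<zeta>)\<close> to a set only remembers that infimum, so the
  \<open>\<zeta>\<close>-difference of \<open>U(t+s,x)\<close> and \<open>U(t,x)\<close> is \<open>{z. v(t+s) - v(t) \<le> \<zeta> \<bullet> z}\<close>, and the set-valued Fenchel
  conjugate at \<open>\<eta>\<close> is \<open>{z. \<l>*(\<eta>) \<le> \<zeta> \<bullet> z}\<close>. What remains is to show that the right derivative of \<open>v\<close>
  at \<open>t\<close> is \<open>\<l>*(p) + \<zeta> \<bullet> w(t,x,\<zeta>)\<close>, together with \<open>p = -d\<^sub>t(T) \<nabla>\<gamma>(Y(T))\<close>.

  The identity for \<open>p\<close> (\<open>minimal_momentum_stationary\<close>): Brouwer's theorem gives a momentum \<open>q\<close> with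
  \<open>q = -d\<^sub>t(T) \<nabla>\<gamma>(Y\<^sub>q(T))\<close>, since \<open>\<nabla>\<gamma>\<close> is bounded. The Fenchel--Young inequality and the convexity of
  \<open>\<gamma>\<close> show that \<open>Y\<^sub>q\<close> beats every other \<open>Y\<^sub>p\<close>, strictly unless the velocities agree, so that a minimal
  \<open>p\<close> equals \<open>q\<close>.

  The derivative: \<open>v\<close> is squeezed between two explicit functions that agree at \<open>t\<close> and have the same
  right derivative there. From above, \<open>v(\<tau>)\<close> is at most the cost of running the optimal velocity
  profile of time \<open>t\<close> on \<open>[\<tau>,T]\<close> only (\<open>value_fun_attains_upper_bound\<close>). From below, freeze
  the optimal endpoint \<open>z\<^sub>0\<close>, put \<open>P\<^sub>\<tau> = -d\<^sub>\<tau>(T) \<nabla>\<gamma>(z\<^sub>0)\<close>, and apply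
  \<open>P\<^sub>\<tau> \<bullet> w - d\<^sub>\<tau>(r) \<l>(w) \<le> d\<^sub>\<tau>(r) \<l>*(P\<^sub>\<tau> / d\<^sub>\<tau>(r))\<close> under the integral and the tangent of \<open>\<gamma>\<close> at \<open>z\<^sub>0\<close> to the
  terminal cost. The velocity of an arbitrary competitor then only enters through its integral and
  cancels (\<open>lower_bound_le_cost\<close>). As the dual bound keeps \<open>z\<^sub>0\<close> fixed, optimal paths for the
  starting times \<open>\<tau> > t\<close> never have to be compared with the one for \<open>t\<close>.

  The cone may contain lines, in which case \<open>L\<close> itself need not be measurable; only \<open>\<l>\<close> is regular.
  The integrable selections needed for the upper bound therefore come from the assumed integrability of
  the vector-valued cost along \<open>Y\<close>, with the discount factor \<open>d\<^sub>t\<close> replaced by \<open>d\<^sub>\<tau>\<close>.\<close>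

section \<open>Half-spaces in the set lattice\<close>

lemma oplus_Hplus:
  fixes A :: "'a::euclidean_space set"
  assumes "\<zeta> \<noteq> 0" "A \<noteq> {}" and bdd: "bdd_below ((\<bullet>) \<zeta> ` A)"
  shows "oplus A (Hplus \<zeta>) = {z. Inf ((\<bullet>) \<zeta> ` A) \<le> \<zeta> \<bullet> z}"
proof
  have "A + Hplus \<zeta> \<subseteq> {z. Inf ((\<bullet>) \<zeta> ` A) \<le> \<zeta> \<bullet> z}"
  proof
    fix z assume "z \<in> A + Hplus \<zeta>"
    then obtain u h where "z = u + h" "u \<in> A" "0 \<le> \<zeta> \<bullet> h"
      by (auto elim!: set_plus_elim simp: Hplus_def)
    moreover from this have "Inf ((\<bullet>) \<zeta> ` A) \<le> \<zeta> \<bullet> u"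
      by (intro cInf_lower bdd) auto
    ultimately show "z \<in> {z. Inf ((\<bullet>) \<zeta> ` A) \<le> \<zeta> \<bullet> z}"
      by (auto simp: inner_add_right)
  qed
  then show "oplus A (Hplus \<zeta>) \<subseteq> {z. Inf ((\<bullet>) \<zeta> ` A) \<le> \<zeta> \<bullet> z}"
    unfolding oplus_def by (intro closure_minimal closed_halfspace_ge)
  show "{z. Inf ((\<bullet>) \<zeta> ` A) \<le> \<zeta> \<bullet> z} \<subseteq> oplus A (Hplus \<zeta>)"
  proof
    fix z assume "z \<in> {z. Inf ((\<bullet>) \<zeta> ` A) \<le> \<zeta> \<bullet> z}"
    then have z: "Inf ((\<bullet>) \<zeta> ` A) \<le> \<zeta> \<bullet> z" by simp
    show "z \<in> oplus A (Hplus \<zeta>)"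
      unfolding oplus_def closure_approachable
    proof (intro allI impI)
      fix e :: real assume "0 < e"
      \<comment> \<open>Shifted by \<open>k *\<^sub>R \<zeta>\<close>, which has norm \<open>e / 2\<close>, the point lies strictly above the infimum and so
        dominates an element of \<open>A\<close>.\<close>
      define k where "k = e / (2 * norm \<zeta>)"
      have "k > 0" using \<open>0 < e\<close> assms(1) by (simp add: k_def)
      then have "Inf ((\<bullet>) \<zeta> ` A) < \<zeta> \<bullet> (z + k *\<^sub>R \<zeta>)"
        using z assms(1) by (simp add: inner_add_right add_strict_increasing2 less_le_trans[of _ "_ + _"] le_less_trans[OF z])
      then obtain u where u: "u \<in> A" "\<zeta> \<bullet> u < \<zeta> \<bullet> (z + k *\<^sub>R \<zeta>)"
        using cInf_less_iff[of "(\<bullet>) \<zeta> ` A"] assms by auto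
      have "u + (z + k *\<^sub>R \<zeta> - u) \<in> A + Hplus \<zeta>"
        using u by (intro set_plus_intro) (auto simp: Hplus_def inner_diff_right)
      moreover have "dist (z + k *\<^sub>R \<zeta>) z < e"
        using \<open>0 < e\<close> \<open>k > 0\<close> assms(1) by (simp add: dist_norm k_def)
      ultimately show "\<exists>y\<in>A + Hplus \<zeta>. dist y z < e" by (auto intro!: bexI[of _ "z + k *\<^sub>R \<zeta>"])
    qed
  qed
qed

lemma zeta_diff_halfspace:
  fixes A B :: "'a::euclidean_space set"
  assumes "\<zeta> \<noteq> 0" "A \<noteq> {}" "bdd_below ((\<bullet>) \<zeta> ` A)" "B \<noteq> {}" "bdd_below ((\<bullet>) \<zeta> ` B)"
  shows "zeta_diff \<zeta> A B = {z. Inf ((\<bullet>) \<zeta> ` A) - Inf ((\<bullet>) \<zeta> ` B) \<le> \<zeta> \<bullet> z}"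
proof -
  have "(+) z ` B \<subseteq> {w. c \<le> \<zeta> \<bullet> w} \<longleftrightarrow> c - \<zeta> \<bullet> z \<le> Inf ((\<bullet>) \<zeta> ` B)" for z c
    using assms(4,5) by (subst le_cInf_iff) (auto simp: inner_add_right algebra_simps)
  then show ?thesis
    unfolding zeta_diff_def oplus_Hplus[OF assms(1-3)] by (auto simp: algebra_simps)
qed

text \<open>For the inclusion \<open>\<supseteq>\<close> a point of the limit half-space is pushed along \<open>\<zeta>\<close> by just as much as it
  fails to lie in the \<open>m\<close>-th half-space; this distance tends to \<open>0\<close>.\<close>

lemma seq_set_lim_halfspaces:
  fixes \<zeta> :: "'a::euclidean_space"
  assumes "\<zeta> \<noteq> 0" and c: "c \<longlonglongrightarrow> c0"
  shows "seq_set_lim (\<lambda>m. {z. c m \<le> \<zeta> \<bullet> z}) = {z. c0 \<le> \<zeta> \<bullet> z}"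
proof (intro equalityI subsetI)
  fix z assume "z \<in> seq_set_lim (\<lambda>m. {z. c m \<le> \<zeta> \<bullet> z})"
  then obtain zs where zs: "\<And>m. c m \<le> \<zeta> \<bullet> zs m" "zs \<longlonglongrightarrow> z"
    by (auto simp: seq_set_lim_def)
  have "c0 \<le> \<zeta> \<bullet> z"
    using zs by (intro LIMSEQ_le[OF c tendsto_inner[OF tendsto_const zs(2)]]) auto
  then show "z \<in> {z. c0 \<le> \<zeta> \<bullet> z}" by simp
next
  fix z assume z: "z \<in> {z. c0 \<le> \<zeta> \<bullet> z}"
  define zs where "zs m = z + (max 0 (c m - \<zeta> \<bullet> z) / (\<zeta> \<bullet> \<zeta>)) *\<^sub>R \<zeta>" for m
  have "c m \<le> \<zeta> \<bullet> zs m" for m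
    using assms(1) by (simp add: zs_def inner_add_right)
  moreover have "zs \<longlonglongrightarrow> z + (max 0 (c0 - \<zeta> \<bullet> z) / (\<zeta> \<bullet> \<zeta>)) *\<^sub>R \<zeta>"
    unfolding zs_def using assms(1) by (intro tendsto_intros c) auto
  moreover have "max 0 (c0 - \<zeta> \<bullet> z) = 0" using z by simp
  ultimately show "z \<in> seq_set_lim (\<lambda>m. {z. c m \<le> \<zeta> \<bullet> z})"
    by (auto simp: seq_set_lim_def)
qed

lemma scaleR_image_halfspace:
  fixes \<zeta> :: "'a::real_inner"
  assumes "0 < s"
  shows "(*\<^sub>R) (1 / s) ` {z. c \<le> \<zeta> \<bullet> z} = {z. c / s \<le> \<zeta> \<bullet> z}"
proof (intro equalityI subsetI)
  fix z assume "z \<in> {z. c / s \<le> \<zeta> \<bullet> z}"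
  then have "z = (1 / s) *\<^sub>R (s *\<^sub>R z)" "c \<le> \<zeta> \<bullet> (s *\<^sub>R z)"
    using assms by (auto simp: field_simps)
  then show "z \<in> (*\<^sub>R) (1 / s) ` {z. c \<le> \<zeta> \<bullet> z}" by blast
qed (use assms in \<open>auto simp: divide_right_mono\<close>)

lemma translate_halfspace:
  fixes \<zeta> :: "'a::real_inner"
  shows "(+) u ` {z. c \<le> \<zeta> \<bullet> z} = {z. c + \<zeta> \<bullet> u \<le> \<zeta> \<bullet> z}"
proof (intro equalityI subsetI)
  fix z assume "z \<in> {z. c + \<zeta> \<bullet> u \<le> \<zeta> \<bullet> z}"
  then have "z = u + (z - u)" "c \<le> \<zeta> \<bullet> (z - u)"
    by (auto simp: inner_diff_right)
  then show "z \<in> (+) u ` {z. c \<le> \<zeta> \<bullet> z}" by blast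
qed (auto simp: inner_add_right)

lemma Inf_inner_translated_cone:
  assumes "\<zeta> \<in> dual_cone C" "0 \<in> C"
  shows "Inf ((\<bullet>) \<zeta> ` (+) u ` C) = \<zeta> \<bullet> u" "bdd_below ((\<bullet>) \<zeta> ` (+) u ` C)"
proof -
  show "Inf ((\<bullet>) \<zeta> ` (+) u ` C) = \<zeta> \<bullet> u"
    using assms by (intro cInf_eq_minimum) (force simp: dual_cone_def inner_add_right)+
  show "bdd_below ((\<bullet>) \<zeta> ` (+) u ` C)"
    using assms by (intro bdd_belowI[of _ "\<zeta> \<bullet> u"]) (auto simp: dual_cone_def inner_add_right)
qed

lemma Inf_inner_S_fun:
  fixes \<zeta> :: "'a::euclidean_space"
  assumes "\<zeta> \<noteq> 0"
  shows "Inf ((\<bullet>) \<zeta> ` S_fun \<eta> \<zeta> w) = \<eta> \<bullet> w" "bdd_below ((\<bullet>) \<zeta> ` S_fun \<eta> \<zeta> w)" "S_fun \<eta> \<zeta> w \<noteq> {}"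
proof -
  define z where "z = ((\<eta> \<bullet> w) / (\<zeta> \<bullet> \<zeta>)) *\<^sub>R \<zeta>"
  have z: "\<zeta> \<bullet> z = \<eta> \<bullet> w" using assms by (simp add: z_def)
  then have "z \<in> S_fun \<eta> \<zeta> w" by (simp add: S_fun_def)
  then show "S_fun \<eta> \<zeta> w \<noteq> {}" by auto
  have "\<eta> \<bullet> w \<in> (\<bullet>) \<zeta> ` S_fun \<eta> \<zeta> w" using z \<open>z \<in> _\<close> by (metis imageI)
  then show "Inf ((\<bullet>) \<zeta> ` S_fun \<eta> \<zeta> w) = \<eta> \<bullet> w"
    by (intro cInf_eq_minimum) (auto simp: S_fun_def)
  show "bdd_below ((\<bullet>) \<zeta> ` S_fun \<eta> \<zeta> w)"
    by (intro bdd_belowI[of _ "\<eta> \<bullet> w"]) (auto simp: S_fun_def)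
qed

text \<open>The conjugate is an intersection of parallel half-spaces. The maximiser \<open>w0\<close> of the scalar
  Legendre problem names the smallest of them.\<close>

lemma fenchel_conj_translated_cone:
  fixes \<zeta> :: "'a::euclidean_space"
  assumes "\<zeta> \<in> dual_cone C" "\<zeta> \<noteq> 0" "0 \<in> C"
    and max: "\<And>w. \<eta> \<bullet> w - \<zeta> \<bullet> F w \<le> \<eta> \<bullet> w0 - \<zeta> \<bullet> F w0"
  shows "fenchel_conj (\<lambda>w. (+) (F w) ` C) \<eta> \<zeta> = {z. \<eta> \<bullet> w0 - \<zeta> \<bullet> F w0 \<le> \<zeta> \<bullet> z}"
proof -
  have "zeta_diff \<zeta> (S_fun \<eta> \<zeta> w) ((+) (F w) ` C) = {z. \<eta> \<bullet> w - \<zeta> \<bullet> F w \<le> \<zeta> \<bullet> z}" for w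
    using assms
    by (subst zeta_diff_halfspace) (auto simp: Inf_inner_S_fun Inf_inner_translated_cone)
  then show ?thesis
    unfolding fenchel_conj_def lat_sup_def using max by (auto intro: order_trans)
qed

text \<open>Existence and value of the derivative of \<open>U\<close> are reduced to two real functions that enclose the
  support values of \<open>U\<close> and touch at \<open>t\<close>. The upper estimate asks for a point of \<open>U \<tau> x\<close>, which also makes
  this set nonempty.\<close>

lemma has_time_deriv_squeeze:
  fixes U :: "real \<Rightarrow> 'b \<Rightarrow> 'a::euclidean_space set"
  assumes "\<zeta> \<noteq> 0" "t \<le> T"
    and lower: "\<And>\<tau> z. t \<le> \<tau> \<Longrightarrow> \<tau> \<le> T \<Longrightarrow> z \<in> U \<tau> x \<Longrightarrow> lo \<tau> \<le> \<zeta> \<bullet> z"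
    and upper: "\<And>\<tau>. t \<le> \<tau> \<Longrightarrow> \<tau> \<le> T \<Longrightarrow> \<exists>z\<in>U \<tau> x. \<zeta> \<bullet> z \<le> up \<tau>"
    and touch: "up t \<le> lo t"
    and lo: "\<And>\<sigma>. (\<And>m. \<sigma> m \<in> {0<..T - t}) \<Longrightarrow> \<sigma> \<longlonglongrightarrow> 0 \<Longrightarrow>
               (\<lambda>m. (lo (t + \<sigma> m) - lo t) / \<sigma> m) \<longlonglongrightarrow> \<Lambda>"
    and up: "\<And>\<sigma>. (\<And>m. \<sigma> m \<in> {0<..T - t}) \<Longrightarrow> \<sigma> \<longlonglongrightarrow> 0 \<Longrightarrow>
               (\<lambda>m. (up (t + \<sigma> m) - up t) / \<sigma> m) \<longlonglongrightarrow> \<Lambda>"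
  shows "has_time_deriv U T \<zeta> t x {z. \<Lambda> \<le> \<zeta> \<bullet> z}"
proof -
  define v where "v \<tau> = Inf ((\<bullet>) \<zeta> ` U \<tau> x)" for \<tau>
  have ne: "U \<tau> x \<noteq> {}" and bdd: "bdd_below ((\<bullet>) \<zeta> ` U \<tau> x)" if "t \<le> \<tau>" "\<tau> \<le> T" for \<tau>
    using upper[OF that] lower[OF that] by (auto intro!: bdd_belowI)
  have lo_v: "lo \<tau> \<le> v \<tau>" if "t \<le> \<tau>" "\<tau> \<le> T" for \<tau>
    unfolding v_def using ne[OF that] lower[OF that] by (intro cInf_greatest) auto
  have v_up: "v \<tau> \<le> up \<tau>" if "t \<le> \<tau>" "\<tau> \<le> T" for \<tau>
  proof -
    obtain z where "z \<in> U \<tau> x" "\<zeta> \<bullet> z \<le> up \<tau>" using upper[OF \<open>t \<le> \<tau>\<close> \<open>\<tau> \<le> T\<close>] by auto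
    then show ?thesis unfolding v_def by (intro cInf_lower2[OF _ _ bdd[OF that]]) auto
  qed
  have diff: "(*\<^sub>R) (1 / s) ` zeta_diff \<zeta> (U (t + s) x) (U t x) =
      {z. (v (t + s) - v t) / s \<le> \<zeta> \<bullet> z}" if "s \<in> {0<..T - t}" for s
    using that assms(1,2) ne bdd
    by (subst zeta_diff_halfspace) (auto simp: v_def scaleR_image_halfspace)
  show ?thesis
    unfolding has_time_deriv_def has_set_limit_def
  proof (intro allI impI, elim conjE)
    fix \<sigma> :: "nat \<Rightarrow> real"
    assume \<sigma>: "\<forall>m. \<sigma> m \<in> {0<..T - t}" "\<sigma> \<longlonglongrightarrow> 0"
    have vt: "v t = lo t" "v t = up t"
      using lo_v[of t] v_up[of t] touch assms(2) by auto
    have "(\<lambda>m. (v (t + \<sigma> m) - v t) / \<sigma> m) \<longlonglongrightarrow> \<Lambda>"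
    proof (rule tendsto_sandwich[OF _ _ lo[OF _ \<sigma>(2)] up[OF _ \<sigma>(2)]])
      have "t \<le> t + \<sigma> m" "t + \<sigma> m \<le> T" "0 < \<sigma> m" for m using \<sigma>(1)[rule_format, of m] by auto
      then show "\<forall>\<^sub>F m in sequentially. (lo (t + \<sigma> m) - lo t) / \<sigma> m \<le> (v (t + \<sigma> m) - v t) / \<sigma> m"
        "\<forall>\<^sub>F m in sequentially. (v (t + \<sigma> m) - v t) / \<sigma> m \<le> (up (t + \<sigma> m) - up t) / \<sigma> m"
        using vt lo_v v_up by (auto intro!: always_eventually divide_right_mono simp: less_imp_le)
    qed (use \<sigma>(1) in auto)
    then show "seq_set_lim (\<lambda>m. (*\<^sub>R) (1 / \<sigma> m) ` zeta_diff \<zeta> (U (t + \<sigma> m) x) (U t x))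
        = {z. \<Lambda> \<le> \<zeta> \<bullet> z}"
      using \<sigma>(1) by (simp add: diff seq_set_lim_halfspaces[OF assms(1)])
  qed
qed

section \<open>Uniqueness of weak derivatives\<close>

text \<open>Extend \<open>w\<close> by \<open>0\<close>. The sets over which it integrates to \<open>0\<close> include the rays \<open>{..s}\<close>, which generate the Borel sets
  and are closed under intersection; by Dynkin's argument they contain all Borel sets, and hence all
  Lebesgue sets, which differ from Borel sets by null sets.\<close>

lemma AE_zero_if_primitive_zero:
  fixes w :: "real \<Rightarrow> 'b::euclidean_space"
  assumes w: "set_integrable lebesgue {a..b} w"
    and prim: "\<And>s. s \<in> {a..b} \<Longrightarrow> (LINT r:{a..s}|lebesgue. w r) = 0"
  shows "AE r\<in>{a..b} in lebesgue. w r = 0"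
proof (cases "a \<le> b")
  case True
  define f where "f r = indicat_real {a..b} r *\<^sub>R w r" for r
  have f: "integrable lebesgue f" using w by (simp add: f_def [abs_def] set_integrable_def)
  have f_set: "set_integrable lebesgue A f" if "A \<in> sets borel" for A
    unfolding set_integrable_def using that by (intro integrable_mult_indicator f) auto
  have total: "integral\<^sup>L lebesgue f = 0"
    using prim[of b] True by (simp add: f_def [abs_def] set_lebesgue_integral_def)
  have atMost: "(LINT r:{..s}|lebesgue. f r) = 0" for s
  proof -
    have "(LINT r:{..s}|lebesgue. f r) = (LINT r:{a..min s b}|lebesgue. w r)"
      unfolding set_lebesgue_integral_def f_def
      by (intro Bochner_Integration.integral_cong) (auto simp: indicator_def)
    then show ?thesis using prim[of "min s b"] True
      by (cases "a \<le> s") (auto simp: set_lebesgue_integral_def)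
  qed
  have borel: "(LINT r:A|lebesgue. f r) = 0" if "A \<in> sets borel" for A
  proof -
    have gen: "(borel :: real measure) = sigma UNIV (range atMost)" by (rule borel_eq_atMost)
    have stable: "Int_stable (range (atMost :: real \<Rightarrow> real set))" by (auto simp: Int_stable_def)
    have "A \<in> sigma_sets UNIV (range atMost)" using that by (simp add: gen)
    with stable have "Int_stable (range (atMost :: real \<Rightarrow> real set))"
      "range (atMost :: real \<Rightarrow> real set) \<subseteq> Pow UNIV" "A \<in> sigma_sets UNIV (range atMost)" by auto
    then show ?thesis
    proof (induction rule: sigma_sets_induct_disjoint)
      case (compl A)
      then have A: "A \<in> sets borel" by (simp add: gen)
      have "integral\<^sup>L lebesgue f = (LINT r:A \<union> (UNIV - A)|lebesgue. f r)"
        by (simp add: set_lebesgue_integral_def)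
      also have "\<dots> = (LINT r:A|lebesgue. f r) + (LINT r:UNIV - A|lebesgue. f r)"
        using A by (intro set_integral_Un f_set) auto
      finally show ?case using compl total by simp
    next
      case (union A)
      then have A: "\<And>i. A i \<in> sets borel" by (simp add: gen image_subset_iff)
      have "(LINT r:(\<Union>i. A i)|lebesgue. f r) = (\<Sum>i. LINT r:A i|lebesgue. f r)"
        using union.hyps A
        by (intro lebesgue_integral_countable_add f_set) (auto simp: disjoint_family_on_def)
      then show ?case using union by simp
    next
      case (basic A)
      then show ?case using atMost by auto
    qed (simp add: set_lebesgue_integral_def)
  qed
  have "AE r in lebesgue. f r = 0"
  proof (rule sigma_finite_measure.density_zero[OF _ f])
    show "sigma_finite_measure (lebesgue :: real measure)"
    proof
      obtain A :: "real set set" where "countable A" "A \<subseteq> sets lborel" "\<Union>A = space lborel"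
        "\<forall>a\<in>A. emeasure lborel a \<noteq> \<infinity>"
        using lborel.sigma_finite_countable by blast
      then show "\<exists>A. countable A \<and> A \<subseteq> sets (lebesgue :: real measure) \<and> \<Union>A = space lebesgue \<and>
          (\<forall>a\<in>A. emeasure lebesgue a \<noteq> \<infinity>)"
        by (intro exI[of _ A]) auto
    qed
    fix A :: "real set" assume A: "A \<in> sets lebesgue"
    obtain S N N' where S: "A = S \<union> N" "N \<subseteq> N'" "N' \<in> null_sets lborel" "S \<in> sets lborel"
      using sets_completionE[OF A] by blast
    have N: "N \<in> null_sets lebesgue" using S(2,3) by (metis null_sets_completionI null_sets_completion_subset)
    then have "(LINT r:A|lebesgue. f r) = (LINT r:S|lebesgue. f r)"
      using S(1,4) A
      by (intro set_integral_null_delta f) (auto intro: null_sets_completion_subset[OF _ N])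
    then show "(LINT r:A|lebesgue. f r) = 0" using borel S(4) by simp
  qed
  then show ?thesis by eventually_elim (auto simp: f_def)
qed auto

text \<open>\<open>weak_deriv\<close> is an arbitrary choice among the densities; by uniqueness it may be replaced
  almost everywhere by any density that is known explicitly.\<close>

lemma has_weak_deriv_unique_AE:
  assumes "has_weak_deriv y u a b" "has_weak_deriv y v a b"
  shows "AE r\<in>{a..b} in lebesgue. u r = v r"
proof -
  have u: "set_integrable lebesgue {a..b} u" "\<And>s. s \<in> {a..b} \<Longrightarrow> y s = y a + (LINT r:{a..s}|lebesgue. u r)"
    and v: "set_integrable lebesgue {a..b} v" "\<And>s. s \<in> {a..b} \<Longrightarrow> y s = y a + (LINT r:{a..s}|lebesgue. v r)"
    using assms unfolding has_weak_deriv_def by blast+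
  have sub: "set_integrable lebesgue {a..s} u" "set_integrable lebesgue {a..s} v" if "s \<le> b" for s
    using that by (auto intro: set_integrable_subset[OF u(1)] set_integrable_subset[OF v(1)])
  have "AE r\<in>{a..b} in lebesgue. u r - v r = 0"
  proof (rule AE_zero_if_primitive_zero)
    fix s assume s: "s \<in> {a..b}"
    have "(LINT r:{a..s}|lebesgue. u r) = (LINT r:{a..s}|lebesgue. v r)"
      using u(2)[OF s] v(2)[OF s] by (metis add_left_cancel)
    then show "(LINT r:{a..s}|lebesgue. u r - v r) = 0"
      using sub s by (simp add: set_integral_diff)
  qed (use u(1) v(1) in auto)
  then show ?thesis by simp
qed

lemma has_weak_deriv_weak_deriv:
  assumes "has_weak_deriv y v a b"
  shows "has_weak_deriv y (weak_deriv a b y) a b"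
  unfolding weak_deriv_def by (rule someI[of "\<lambda>v. has_weak_deriv y v a b", OF assms])

section \<open>Gradients of strictly convex superlinear functions\<close>

lemma GDERIV_unique:
  assumes "GDERIV f x :> D" "GDERIV f x :> D'"
  shows "D = D'"
proof -
  have "(\<lambda>h. h \<bullet> D) = (\<lambda>h. h \<bullet> D')"
    using assms unfolding gderiv_def by (rule has_derivative_unique)
  then have "(D - D') \<bullet> D = (D - D') \<bullet> D'" by meson
  then have "(D - D') \<bullet> (D - D') = 0" by (simp only: inner_diff_right[of "D - D'" D D'])
  then show ?thesis by simp
qed

lemma grad_eq: "GDERIV f x :> D \<Longrightarrow> grad f x = D"
  unfolding grad_def using GDERIV_unique by blast

lemma C2_GDERIV:
  assumes "C2 f"
  shows "GDERIV f x :> grad f x"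
  using assms grad_eq unfolding C2_def by metis

lemma C2_continuous_on_grad:
  assumes "C2 f"
  shows "continuous_on S (grad f)"
  using assms unfolding C2_def
  by (meson continuous_at_imp_continuous_on has_derivative_continuous)

lemma C2_continuous_on:
  assumes "C2 f"
  shows "continuous_on S f"
  using C2_GDERIV[OF assms] unfolding gderiv_def
  by (meson continuous_at_imp_continuous_on has_derivative_continuous)

lemma C2_scale:
  assumes "C2 f"
  shows "C2 (\<lambda>x. c * f x)"
proof -
  have D: "GDERIV (\<lambda>x. c * f x) x :> c *\<^sub>R grad f x" for x
    using C2_GDERIV[OF assms, of x] unfolding gderiv_def
    by (auto intro!: derivative_eq_intros)
  have g: "grad (\<lambda>x. c * f x) = (\<lambda>x. c *\<^sub>R grad f x)"
    using D by (auto intro!: grad_eq)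
  obtain H where H: "continuous_on UNIV H" "\<And>x. (grad f has_derivative blinfun_apply (H x)) (at x)"
    using assms unfolding C2_def by auto
  have "continuous_on UNIV (\<lambda>x. c *\<^sub>R H x)"
    by (intro continuous_intros H)
  moreover have "((\<lambda>x. c *\<^sub>R grad f x) has_derivative blinfun_apply (c *\<^sub>R H x)) (at x)" for x
    using has_derivative_scaleR_right[OF H(2), of c x] by (simp add: scaleR_blinfun.rep_eq)
  ultimately show ?thesis unfolding C2_def g using D by blast
qed

lemma strictly_convex_imp_convex_on:
  assumes "strictly_convex f"
  shows "convex_on UNIV f"
proof (rule convex_onI)
  fix u x y assume "0 < u" "u < (1::real)"
  then show "f ((1 - u) *\<^sub>R x + u *\<^sub>R y) \<le> (1 - u) * f x + u * f y"
    using assms by (cases "x = y") (auto simp: strictly_convex_def algebra_simps less_imp_le)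
qed auto

text \<open>Restricting \<open>f\<close> to the line through \<open>x\<close> and \<open>y\<close> reduces this to convex functions of a real
  variable.\<close>

lemma convex_on_above_tangent:
  assumes conv: "convex_on UNIV f" and D: "GDERIV f x :> D"
  shows "f x + D \<bullet> (y - x) \<le> f y"
proof -
  define \<phi> where "\<phi> u = f (x + u *\<^sub>R (y - x))" for u
  have "convex_on UNIV \<phi>"
  proof (rule convex_onI)
    fix s u v :: real assume s: "0 < s" "s < 1"
    have "x + ((1 - s) *\<^sub>R u + s *\<^sub>R v) *\<^sub>R (y - x) =
        (1 - s) *\<^sub>R (x + u *\<^sub>R (y - x)) + s *\<^sub>R (x + v *\<^sub>R (y - x))"
      by (simp add: algebra_simps)
    then show "\<phi> ((1 - s) *\<^sub>R u + s *\<^sub>R v) \<le> (1 - s) * \<phi> u + s * \<phi> v"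
      unfolding \<phi>_def using s by (simp only:) (intro convex_onD[OF conv], auto)
  qed auto
  moreover have "(\<phi> has_field_derivative D \<bullet> (y - x)) (at 0)"
  proof -
    have "(f has_derivative (\<lambda>h. h \<bullet> D)) (at (x + 0 *\<^sub>R (y - x)))"
      using D by (simp add: gderiv_def)
    moreover have "((\<lambda>u. x + u *\<^sub>R (y - x)) has_derivative (\<lambda>u. u *\<^sub>R (y - x))) (at 0)"
      by (auto intro!: derivative_eq_intros)
    ultimately have "(\<phi> has_derivative (\<lambda>u. (u *\<^sub>R (y - x)) \<bullet> D)) (at 0)"
      unfolding \<phi>_def by (rule has_derivative_compose[rotated])
    moreover have "(\<lambda>u. (u *\<^sub>R (y - x)) \<bullet> D) = (*) (D \<bullet> (y - x))"
      by (simp add: fun_eq_iff inner_commute)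
    ultimately show ?thesis by (simp add: has_field_derivative_def)
  qed
  ultimately have "D \<bullet> (y - x) * (1 - 0) \<le> \<phi> 1 - \<phi> 0"
    by (intro convex_on_imp_above_tangent[of UNIV]) auto
  then show ?thesis by (simp add: \<phi>_def)
qed

text \<open>The weak inequality at the midpoint of \<open>x\<close> and \<open>y\<close>, combined with strict convexity there, gives
  the strict inequality at \<open>y\<close>.\<close>

lemma strictly_convex_above_tangent:
  assumes conv: "strictly_convex f" and D: "GDERIV f x :> D" and "y \<noteq> x"
  shows "f x + D \<bullet> (y - x) < f y"
proof -
  define m where "m = (1 - 1/2) *\<^sub>R x + (1/2) *\<^sub>R y"
  have half: "(1/2) *\<^sub>R x + (1/2) *\<^sub>R x = x" by (simp flip: scaleR_left_distrib)
  have "f m < (1 - 1/2) * f x + (1/2) * f y"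
    using conv \<open>y \<noteq> x\<close> unfolding m_def strictly_convex_def by (metis field_sum_of_halves half_gt_zero_iff less_add_same_cancel1 zero_less_one)
  moreover have "m - x = (1/2) *\<^sub>R (y - x)"
    by (simp add: m_def algebra_simps half)
  then have "f x + (D \<bullet> (y - x)) / 2 \<le> f m"
    using convex_on_above_tangent[OF strictly_convex_imp_convex_on[OF conv] D, of m] by simp
  ultimately show ?thesis by (simp add: field_simps)
qed

text \<open>For such a function \<open>\<l>\<close> the gradient is a homeomorphism, and its inverse \<open>vel\<close> sends a momentum
  to the velocity that maximises \<open>w \<mapsto> \<xi> \<bullet> w - \<l> w\<close>.\<close>

locale superlinear_convex =
  fixes \<l> :: "'b::euclidean_space \<Rightarrow> real"
  assumes smooth: "C2 \<l>" and strict: "strictly_convex \<l>" and superlinear: "coercive \<l>"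
begin

abbreviation vel :: "'b \<Rightarrow> 'b" where
  "vel \<equiv> inv (grad \<l>)"

lemma inj_grad: "inj (grad \<l>)"
proof (rule injI, rule ccontr)
  fix x y assume eq: "grad \<l> x = grad \<l> y" and "x \<noteq> y"
  have "\<l> x + grad \<l> x \<bullet> (y - x) < \<l> y" "\<l> y + grad \<l> y \<bullet> (x - y) < \<l> x"
    using \<open>x \<noteq> y\<close> by (auto intro!: strictly_convex_above_tangent[OF strict] C2_GDERIV smooth)
  then show False using eq by (simp add: inner_diff_right)
qed

text \<open>By superlinear growth \<open>w \<mapsto> \<l> w - w \<bullet> \<xi>\<close> attains its minimum, and the minimiser has gradient
  \<open>\<xi>\<close>.\<close>

lemma surj_grad: "surj (grad \<l>)"
proof -
  have "\<exists>w. grad \<l> w = \<xi>" for \<xi>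
  proof -
    define h where "h w = \<l> w - w \<bullet> \<xi>" for w
    have "\<forall>\<^sub>F w in at_infinity. norm \<xi> + \<bar>\<l> 0\<bar> + 1 \<le> \<l> w / norm w"
      using superlinear unfolding coercive_def filterlim_at_top by blast
    then obtain R where R: "\<And>w. R \<le> norm w \<Longrightarrow> norm \<xi> + \<bar>\<l> 0\<bar> + 1 \<le> \<l> w / norm w"
      unfolding eventually_at_infinity by blast
    \<comment> \<open>Radius at least \<open>1\<close>, so that the constant \<open>\<bar>\<l> 0\<bar>\<close> is absorbed by \<open>\<bar>\<l> 0\<bar> * norm w\<close>.\<close>
    define R' where "R' = max R 1"
    have out: "h 0 \<le> h w" if "R' \<le> norm w" for w
    proof -
      have w: "R \<le> norm w" "1 \<le> norm w" using that by (auto simp: R'_def)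
      then have "0 < norm w" by linarith
      then have "(norm \<xi> + \<bar>\<l> 0\<bar> + 1) * norm w \<le> \<l> w"
        using R[OF w(1)] by (simp add: pos_le_divide_eq)
      moreover have "w \<bullet> \<xi> \<le> norm w * norm \<xi>" by (rule norm_cauchy_schwarz)
      moreover have "\<bar>\<l> 0\<bar> * 1 \<le> \<bar>\<l> 0\<bar> * norm w" using w by (intro mult_left_mono) auto
      ultimately show ?thesis using w by (simp add: h_def algebra_simps)
    qed
    have "continuous_on (cball 0 R') h"
      unfolding h_def by (intro continuous_intros C2_continuous_on smooth)
    then obtain w where w: "w \<in> cball 0 R'" "\<And>v. v \<in> cball 0 R' \<Longrightarrow> h w \<le> h v"
      using continuous_attains_inf[of "cball 0 R'" h] by (auto simp: R'_def)
    have min: "h w \<le> h v" for v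
    proof (cases "norm v \<le> R'")
      case False
      have "h w \<le> h 0" by (rule w(2)) (simp add: R'_def)
      also have "h 0 \<le> h v" using False by (intro out) simp
      finally show ?thesis .
    qed (simp add: w(2))
    have "(h has_derivative (\<lambda>k. k \<bullet> (grad \<l> w - \<xi>))) (at w)"
      using C2_GDERIV[OF smooth, of w] unfolding h_def gderiv_def
      by (auto intro!: derivative_eq_intros simp: inner_diff_right)
    then have "(\<lambda>k. k \<bullet> (grad \<l> w - \<xi>)) = (\<lambda>k. 0)"
      using min by (intro differential_zero_maxmin[of w UNIV h]) auto
    then have "(grad \<l> w - \<xi>) \<bullet> (grad \<l> w - \<xi>) = 0" by meson
    then show ?thesis by auto
  qed
  then show ?thesis by (metis surjI)
qed

lemma grad_vel [simp]: "grad \<l> (vel \<xi>) = \<xi>"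
  by (rule surj_f_inv_f[OF surj_grad])

text \<open>Invariance of domain: a continuous injection between spaces of equal dimension has a continuous
  inverse.\<close>

lemma continuous_on_vel: "continuous_on S vel"
proof -
  have "continuous_on (grad \<l> ` UNIV) vel"
    by (rule continuous_on_inverse_open) (auto intro: C2_continuous_on_grad smooth inj_grad inv_f_f)
  then show ?thesis by (rule continuous_on_subset) (simp add: surj_grad)
qed

text \<open>This is \<open>c \<l>*(P / c)\<close>, the conjugate of \<open>c \<l>\<close> at \<open>P\<close>, written through its maximiser
  \<open>vel (P / c)\<close> so that no supremum has to be handled.\<close>

definition perspective_conj :: "'b \<Rightarrow> real \<Rightarrow> real" where
  "perspective_conj P c = P \<bullet> vel ((1 / c) *\<^sub>R P) - c * \<l> (vel ((1 / c) *\<^sub>R P))"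

lemma fenchel_young:
  assumes "0 < c"
  shows "P \<bullet> w - c * \<l> w \<le> perspective_conj P c"
proof -
  let ?w = "vel ((1 / c) *\<^sub>R P)"
  have "\<l> ?w + ((1 / c) *\<^sub>R P) \<bullet> (w - ?w) \<le> \<l> w"
    using convex_on_above_tangent[OF strictly_convex_imp_convex_on[OF strict] C2_GDERIV[OF smooth], of ?w w]
    by simp
  then have "c * (\<l> ?w + ((1 / c) *\<^sub>R P) \<bullet> (w - ?w)) \<le> c * \<l> w"
    using assms by (intro mult_left_mono) auto
  then show ?thesis
    using assms by (simp add: perspective_conj_def distrib_left inner_diff_right right_diff_distrib)
qed

lemma fenchel_young_eq_iff:
  assumes "0 < c"
  shows "P \<bullet> w - c * \<l> w = perspective_conj P c \<longleftrightarrow> w = vel ((1 / c) *\<^sub>R P)"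
proof
  assume eq: "P \<bullet> w - c * \<l> w = perspective_conj P c"
  let ?w = "vel ((1 / c) *\<^sub>R P)"
  show "w = ?w"
  proof (rule ccontr)
    assume "w \<noteq> ?w"
    then have "\<l> ?w + ((1 / c) *\<^sub>R P) \<bullet> (w - ?w) < \<l> w"
      using strictly_convex_above_tangent[OF strict C2_GDERIV[OF smooth], of w ?w] by simp
    then have "c * (\<l> ?w + ((1 / c) *\<^sub>R P) \<bullet> (w - ?w)) < c * \<l> w"
      using assms by (intro mult_strict_left_mono) auto
    then show False
      using assms eq by (simp add: perspective_conj_def distrib_left inner_diff_right right_diff_distrib)
  qed
qed (simp add: perspective_conj_def)

end

section \<open>Two limits along sequences of time increments\<close>

lemma difference_quotient_LIMSEQ:
  fixes f :: "real \<Rightarrow> real"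
  assumes "(f has_real_derivative D) (at t within {t..b})" "t < b"
    and \<sigma>: "\<And>m. 0 < \<sigma> m" "\<sigma> \<longlonglongrightarrow> 0"
  shows "(\<lambda>m. (f (t + \<sigma> m) - f t) / \<sigma> m) \<longlonglongrightarrow> D"
proof -
  have "((\<lambda>y. (f y - f t) / (y - t)) \<longlongrightarrow> D) (at t within {t..b})"
    using assms(1) by (simp add: has_field_derivative_iff)
  moreover have "filterlim (\<lambda>m. t + \<sigma> m) (at t within {t..b}) sequentially"
  proof -
    have "\<forall>\<^sub>F m in sequentially. \<sigma> m < b - t"
      using \<sigma>(2) assms(2) by (intro order_tendstoD) auto
    then have "\<forall>\<^sub>F m in sequentially. t + \<sigma> m \<in> {t..b} - {t}"
    proof eventually_elim
      case (elim m)
      then show ?case using \<sigma>(1)[of m] by auto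
    qed
    moreover have "(\<lambda>m. t + \<sigma> m) \<longlonglongrightarrow> t"
      using tendsto_add[OF tendsto_const \<sigma>(2), of t] by simp
    ultimately show ?thesis
      unfolding filterlim_at by (auto simp: eventually_conj_iff elim!: eventually_mono)
  qed
  ultimately have "(\<lambda>m. (f (t + \<sigma> m) - f t) / (t + \<sigma> m - t)) \<longlonglongrightarrow> D"
    by (rule filterlim_compose)
  then show ?thesis by simp
qed

text \<open>Dominated convergence after extending the integrands by \<open>0\<close> to \<open>{t..T}\<close>. Convergence is only
  asked for \<open>r > t\<close>, because \<open>d (t + \<sigma> m) r\<close> has no meaning until \<open>t + \<sigma> m \<le> r\<close>.\<close>

lemma integral_shrinking_interval_LIMSEQ:
  fixes h :: "nat \<Rightarrow> real \<Rightarrow> real"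
  assumes \<sigma>: "\<And>m. \<sigma> m \<in> {0<..T - t}" "\<sigma> \<longlonglongrightarrow> 0"
    and int: "\<And>m. h m integrable_on {t + \<sigma> m..T}"
    and bound: "\<And>m r. r \<in> {t + \<sigma> m..T} \<Longrightarrow> \<bar>h m r\<bar> \<le> K"
    and lim: "\<And>r. t < r \<Longrightarrow> r \<le> T \<Longrightarrow> (\<lambda>m. h m r) \<longlonglongrightarrow> h0 r"
  shows "(\<lambda>m. integral {t + \<sigma> m..T} (h m)) \<longlonglongrightarrow> integral {t..T} h0"
proof -
  define f where "f m r = (if r \<in> {t + \<sigma> m..T} then h m r else 0)" for m r
  define g where "g r = (if r = t then 0 else h0 r)" for r
  have sub: "{t + \<sigma> m..T} \<subseteq> {t..T}" for m using \<sigma>(1)[of m] by auto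
  have "(\<lambda>m. integral {t..T} (f m)) \<longlonglongrightarrow> integral {t..T} g"
  proof (rule dominated_convergence)
    show "f m integrable_on {t..T}" for m
      unfolding f_def integrable_restrict_Int Int_absorb2[OF sub] by (rule int)
    have "0 \<le> K" using bound[of T 0] \<sigma>(1)[of 0] by auto
    then show "norm (f m r) \<le> K" for m r using bound by (simp add: f_def)
    fix r assume r: "r \<in> {t..T}"
    show "(\<lambda>m. f m r) \<longlonglongrightarrow> g r"
    proof (cases "r = t")
      case True
      have "f m r = 0" for m using \<sigma>(1)[of m] True by (auto simp: f_def)
      then show ?thesis by (simp add: g_def True)
    next
      case False
      with r have "t < r" "r \<le> T" by auto
      have "\<forall>\<^sub>F m in sequentially. \<sigma> m < r - t"
        using \<open>t < r\<close> by (intro order_tendstoD(2)[OF \<sigma>(2)]) auto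
      then have "\<forall>\<^sub>F m in sequentially. h m r = f m r"
        by eventually_elim (use \<open>r \<le> T\<close> in \<open>auto simp: f_def\<close>)
      with lim[OF \<open>t < r\<close> \<open>r \<le> T\<close>] False show ?thesis
        by (auto simp: g_def intro: Lim_transform_eventually)
    qed
  qed auto
  moreover have "integral {t..T} (f m) = integral {t + \<sigma> m..T} (h m)" for m
    unfolding f_def integral_restrict_Int Int_absorb2[OF sub] ..
  moreover have "integral {t..T} g = integral {t..T} h0"
    by (rule integral_spike[of "{t}"]) (auto simp: g_def)
  ultimately show ?thesis by simp
qed

section \<open>The scalarised control problem\<close>

text \<open>Moving from \<open>z\<close> by the gradient itself raises \<open>f\<close> by at least its squared norm.\<close>

lemma norm_grad_le_lipschitz:
  assumes "convex_on UNIV f" "C2 f" "K-lipschitz_on UNIV f"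
  shows "norm (grad f z) \<le> K"
proof (cases "grad f z = 0")
  case False
  let ?D = "grad f z"
  have "f z + ?D \<bullet> (z + ?D - z) \<le> f (z + ?D)"
    by (intro convex_on_above_tangent assms C2_GDERIV)
  moreover have "\<bar>f (z + ?D) - f z\<bar> \<le> K * norm ?D"
    using lipschitz_onD[OF assms(3), of "z + ?D" z] by (simp add: dist_norm)
  ultimately have "norm ?D * norm ?D \<le> K * norm ?D"
    by (simp add: dot_square_norm power2_eq_square)
  then show ?thesis using False by simp
qed (use lipschitz_on_nonneg[OF assms(3)] in simp)

lemma set_integral_inner:
  fixes f :: "'a \<Rightarrow> 'b::euclidean_space"
  assumes "set_integrable M A f"
  shows "set_integrable M A (\<lambda>r. \<zeta> \<bullet> f r)" "(LINT r:A|M. \<zeta> \<bullet> f r) = \<zeta> \<bullet> (LINT r:A|M. f r)"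
  using assms by (simp_all add: set_integrable_def set_lebesgue_integral_def flip: inner_scaleR_right)

text \<open>The scalar problem of minimising \<open>\<integral> d t r * \<l> (y' r) dr + d t T * \<gamma> (y T)\<close> over paths that start
  in \<open>x\<close>. In the application \<open>\<l>\<close> and \<open>\<gamma>\<close> are the components of \<open>L\<close> and \<open>g\<close> in the direction \<open>\<zeta>\<close>.\<close>

locale discounted_control = superlinear_convex \<l> for \<l> :: "'b::euclidean_space \<Rightarrow> real" +
  fixes \<gamma> :: "'b \<Rightarrow> real" and d d' :: "real \<Rightarrow> real \<Rightarrow> real" and T a t :: real and x :: 'b
  assumes \<gamma>_C2: "C2 \<gamma>" and \<gamma>_convex: "convex_on UNIV \<gamma>"
    and \<gamma>_lipschitz: "\<exists>K. K-lipschitz_on UNIV \<gamma>"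
    and t_less: "t < T" and a_pos: "0 < a"
    and d_range: "\<And>\<tau>. t \<le> \<tau> \<Longrightarrow> \<tau> \<le> T \<Longrightarrow> d \<tau> ` {\<tau>..T} \<subseteq> {a<..1}"
    and d_continuous: "\<And>\<tau>. t \<le> \<tau> \<Longrightarrow> \<tau> \<le> T \<Longrightarrow> continuous_on {\<tau>..T} (d \<tau>)"
    and d_start: "d t t = 1"
    and d_deriv: "\<And>\<tau> s. t \<le> \<tau> \<Longrightarrow> \<tau> \<le> s \<Longrightarrow> s \<le> T \<Longrightarrow>
      ((\<lambda>\<tau>. d \<tau> s) has_real_derivative d' \<tau> s) (at \<tau> within {t..s})"
    and d'_continuous: "continuous_on {(\<tau>, s). t \<le> \<tau> \<and> \<tau> \<le> s \<and> s \<le> T} (\<lambda>(\<tau>, s). d' \<tau> s)"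
begin

lemma d_bounds:
  assumes "t \<le> \<tau>" "\<tau> \<le> r" "r \<le> T"
  shows "a < d \<tau> r" "0 < d \<tau> r" "d \<tau> r \<le> 1"
  using d_range[of \<tau>] assms a_pos by (force simp: image_subset_iff)+

text \<open>The constant is a bound of the continuous \<open>d'\<close> on the compact triangle; it dominates all
  difference quotients of the discount factor in its first argument.\<close>

lemma d_lipschitz:
  obtains M where "0 \<le> M"
    "\<And>\<tau> s. t \<le> \<tau> \<Longrightarrow> \<tau> \<le> s \<Longrightarrow> s \<le> T \<Longrightarrow> \<bar>d \<tau> s - d t s\<bar> \<le> M * (\<tau> - t)"
proof -
  let ?S = "{z :: real \<times> real. t \<le> fst z \<and> fst z \<le> snd z \<and> snd z \<le> T}"
  have "closed ?S" by (intro closed_Collect_conj closed_Collect_le continuous_intros)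
  moreover have "bounded ?S"
    by (rule bounded_subset[OF bounded_cbox[of "(t, t)" "(T, T)"]]) (auto simp: cbox_Pair_eq)
  ultimately have "compact ?S" by (simp add: compact_eq_bounded_closed)
  moreover have "continuous_on ?S (\<lambda>(\<tau>, s). d' \<tau> s)"
    using d'_continuous by (simp add: case_prod_unfold)
  ultimately have "bounded ((\<lambda>(\<tau>, s). d' \<tau> s) ` ?S)"
    by (intro compact_imp_bounded compact_continuous_image)
  then obtain M where M: "0 < M" "\<And>\<tau> s. t \<le> \<tau> \<Longrightarrow> \<tau> \<le> s \<Longrightarrow> s \<le> T \<Longrightarrow> \<bar>d' \<tau> s\<bar> \<le> M"
    unfolding bounded_pos by fastforce
  show thesis
  proof
    show "0 \<le> M" using M by simp
    fix \<tau> s assume "t \<le> \<tau>" "\<tau> \<le> s" "s \<le> T"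
    then have "norm (d \<tau> s - d t s) \<le> M * norm (\<tau> - t)"
      using M(2) by (intro field_differentiable_bound[of "{t..s}" _ "\<lambda>\<tau>. d' \<tau> s"] d_deriv) auto
    then show "\<bar>d \<tau> s - d t s\<bar> \<le> M * (\<tau> - t)" using \<open>t \<le> \<tau>\<close> by simp
  qed
qed

lemma d_quotient_LIMSEQ:
  assumes "\<And>m. \<sigma> m \<in> {0<..T - t}" "\<sigma> \<longlonglongrightarrow> 0" "t < r" "r \<le> T"
  shows "(\<lambda>m. (d (t + \<sigma> m) r - d t r) / \<sigma> m) \<longlonglongrightarrow> d' t r"
  using assms by (intro difference_quotient_LIMSEQ[OF d_deriv[of t r]]) auto

lemma d_LIMSEQ:
  assumes "\<And>m. \<sigma> m \<in> {0<..T - t}" "\<sigma> \<longlonglongrightarrow> 0" "t < r" "r \<le> T"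
  shows "(\<lambda>m. d (t + \<sigma> m) r) \<longlonglongrightarrow> d t r"
proof -
  have "(\<lambda>m. (d (t + \<sigma> m) r - d t r) / \<sigma> m * \<sigma> m + d t r) \<longlonglongrightarrow> d' t r * 0 + d t r"
    by (intro tendsto_intros d_quotient_LIMSEQ assms)
  moreover have "\<sigma> m \<noteq> 0" for m using assms(1)[of m] by auto
  ultimately show ?thesis by simp
qed

lemma continuous_on_d'_start: "continuous_on {t..T} (d' t)"
proof -
  have "continuous_on {t..T} (\<lambda>r. case (t, r) of (\<tau>, s) \<Rightarrow> d' \<tau> s)"
    by (rule continuous_on_compose2[OF d'_continuous]) (auto intro!: continuous_intros)
  then show ?thesis by simp
qed

text \<open>The velocity at time \<open>r\<close> that is optimal for momentum \<open>P\<close> when the discounting starts at \<open>\<tau>\<close>; for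
  \<open>\<tau> = t\<close> it is the density of \<open>Y\<close>.\<close>

definition opt_vel :: "'b \<Rightarrow> real \<Rightarrow> real \<Rightarrow> 'b" where
  "opt_vel P \<tau> r = vel ((1 / d \<tau> r) *\<^sub>R P)"

lemma continuous_on_opt_vel:
  assumes "t \<le> \<tau>" "\<tau> \<le> T"
  shows "continuous_on {\<tau>..T} (opt_vel P \<tau>)"
  unfolding opt_vel_def
proof (rule continuous_on_compose2[OF continuous_on_vel[of UNIV]])
  have "d \<tau> r \<noteq> 0" if "r \<in> {\<tau>..T}" for r using d_bounds(2)[of \<tau> r] that assms by auto
  then show "continuous_on {\<tau>..T} (\<lambda>r. (1 / d \<tau> r) *\<^sub>R P)"
    by (intro continuous_intros d_continuous assms) auto
qed auto

lemma continuous_on_cost_opt_vel: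
  assumes "t \<le> \<tau>" "\<tau> \<le> T"
  shows "continuous_on {\<tau>..T} (\<lambda>r. \<l> (opt_vel P \<tau> r))"
  by (rule continuous_on_compose2[OF C2_continuous_on[OF smooth, of UNIV] continuous_on_opt_vel[OF assms]]) auto

lemma perspective_conj_opt_vel:
  "perspective_conj P (d \<tau> r) = P \<bullet> opt_vel P \<tau> r - d \<tau> r * \<l> (opt_vel P \<tau> r)"
  by (simp add: perspective_conj_def opt_vel_def)

lemma continuous_on_perspective_conj:
  assumes "t \<le> \<tau>" "\<tau> \<le> T"
  shows "continuous_on {\<tau>..T} (\<lambda>r. perspective_conj P (d \<tau> r))"
  unfolding perspective_conj_opt_vel
  by (intro continuous_intros continuous_on_opt_vel continuous_on_cost_opt_vel d_continuous assms)

definition endpoint :: "'b \<Rightarrow> 'b" where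
  "endpoint q = x + integral {t..T} (opt_vel q t)"

definition path_cost :: "'b \<Rightarrow> real" where
  "path_cost q = integral {t..T} (\<lambda>r. d t r * \<l> (opt_vel q t r)) + d t T * \<gamma> (endpoint q)"

lemma inner_integral_opt_vel:
  assumes "t \<le> \<tau>" "\<tau> \<le> T"
  shows "P \<bullet> integral {\<tau>..T} (opt_vel q \<tau>) = integral {\<tau>..T} (\<lambda>r. P \<bullet> opt_vel q \<tau> r)"
  using integral_linear[OF integrable_continuous_real[OF continuous_on_opt_vel[OF assms, of q]]
      bounded_linear_inner_right[of P]]
  by (simp add: o_def)

text \<open>Along \<open>opt_vel q t\<close> the Fenchel--Young inequality is an equality at every time.\<close>

lemma path_cost_conj:
  "path_cost q = q \<bullet> (endpoint q - x) - integral {t..T} (\<lambda>r. perspective_conj q (d t r))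
     + d t T * \<gamma> (endpoint q)"
proof -
  have "integral {t..T} (\<lambda>r. perspective_conj q (d t r)) =
     integral {t..T} (\<lambda>r. q \<bullet> opt_vel q t r) - integral {t..T} (\<lambda>r. d t r * \<l> (opt_vel q t r))"
    unfolding perspective_conj_opt_vel using t_less
    by (intro integral_diff integrable_continuous_real continuous_intros continuous_on_opt_vel
        continuous_on_cost_opt_vel d_continuous) auto
  then show ?thesis
    using t_less by (simp add: path_cost_def endpoint_def inner_integral_opt_vel)
qed

lemma endpoint_cost_tangent:
  "\<gamma> z + grad \<gamma> z \<bullet> (y - z) \<le> \<gamma> y"
  by (intro convex_on_above_tangent \<gamma>_convex C2_GDERIV \<gamma>_C2)

text \<open>The transversality condition is a fixed point equation for \<open>q\<close>. Its right-hand side is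
  continuous and bounded by the Lipschitz constant of \<open>\<gamma>\<close>, so Brouwer's theorem applies on a large
  ball.\<close>

lemma exists_stationary_momentum:
  obtains q where "q = - (d t T *\<^sub>R grad \<gamma> (endpoint q))"
proof -
  obtain K where K: "K-lipschitz_on UNIV \<gamma>" using \<gamma>_lipschitz by auto
  \<comment> \<open>A constant \<open>\<gamma>\<close> has Lipschitz constant \<open>0\<close>, but the ball must have positive radius.\<close>
  define R where "R = K + 1"
  have "0 < R" using lipschitz_on_nonneg[OF K] by (simp add: R_def)
  define \<phi> where "\<phi> q = - (d t T *\<^sub>R grad \<gamma> (endpoint q))" for q
  have "continuous_on (cball 0 R \<times> cbox t T) (\<lambda>(q, r). opt_vel q t r)"
    unfolding case_prod_unfold opt_vel_def
  proof (rule continuous_on_compose2[OF continuous_on_vel[of UNIV]])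
    have "continuous_on (cball 0 R \<times> cbox t T) (\<lambda>z::'b \<times> real. d t (snd z))"
      using t_less by (intro continuous_on_compose2[OF d_continuous[of t] continuous_on_snd]) auto
    moreover have "d t r \<noteq> 0" if "r \<in> {t..T}" for r using d_bounds(2)[of t r] that by auto
    ultimately show "continuous_on (cball 0 R \<times> cbox t T) (\<lambda>z::'b \<times> real. (1 / d t (snd z)) *\<^sub>R fst z)"
      by (intro continuous_intros) auto
  qed auto
  then have "continuous_on (cball 0 R) endpoint"
    unfolding endpoint_def
    using integral_continuous_on_param[of "cball 0 R" t T "\<lambda>q r. opt_vel q t r"]
    by (intro continuous_intros) simp
  then have "continuous_on (cball 0 R) \<phi>"
    unfolding \<phi>_def
    by (intro continuous_intros continuous_on_compose2[OF C2_continuous_on_grad[OF \<gamma>_C2, of UNIV]]) auto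
  moreover have "\<phi> q \<in> cball 0 R" for q
  proof -
    have "norm (\<phi> q) \<le> 1 * K"
      unfolding \<phi>_def norm_minus_cancel norm_scaleR
      using d_bounds[of t T] t_less norm_grad_le_lipschitz[OF \<gamma>_convex \<gamma>_C2 K]
      by (intro mult_mono) auto
    then show ?thesis by (simp add: R_def)
  qed
  ultimately obtain q where "\<phi> q = q"
    using brouwer_ball[OF \<open>0 < R\<close>, of 0 \<phi>] by auto
  then show thesis using that[of q] by (simp add: \<phi>_def)
qed

text \<open>For the stationary \<open>q\<close> and any \<open>p\<close>, the difference of the costs is the integral of the
  Fenchel--Young gap of the velocities of \<open>p\<close> with respect to \<open>q\<close>, plus a term that is nonnegative by
  convexity of \<open>\<gamma>\<close>. If \<open>p\<close> is minimal, the gap integrates to \<open>0\<close>, so it vanishes, in particular at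
  time \<open>t\<close>, where it forces \<open>p = q\<close>.\<close>

lemma minimal_momentum_stationary:
  assumes min: "\<And>q. path_cost p \<le> path_cost q"
  shows "p = - (d t T *\<^sub>R grad \<gamma> (endpoint p))"
proof -
  obtain q where q: "q = - (d t T *\<^sub>R grad \<gamma> (endpoint q))" by (rule exists_stationary_momentum)
  \<comment> \<open>The loss in the Fenchel--Young inequality for momentum \<open>q\<close> when the velocity of \<open>p\<close> is used.\<close>
  define gap where "gap r = perspective_conj q (d t r) - (q \<bullet> opt_vel p t r - d t r * \<l> (opt_vel p t r))" for r
  have cont: "continuous_on {t..T} gap"
    unfolding gap_def using t_less
    by (intro continuous_intros continuous_on_opt_vel continuous_on_cost_opt_vel d_continuous
        continuous_on_perspective_conj) auto
  have nonneg: "0 \<le> gap r" if "r \<in> {t..T}" for r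
    using fenchel_young[OF d_bounds(2)[of t r], of q] that by (simp add: gap_def)
  have integrable: "(\<lambda>r. perspective_conj q (d t r)) integrable_on {t..T}"
    "(\<lambda>r. q \<bullet> opt_vel p t r) integrable_on {t..T}"
    "(\<lambda>r. d t r * \<l> (opt_vel p t r)) integrable_on {t..T}"
    using t_less by (auto intro!: integrable_continuous_real continuous_intros continuous_on_opt_vel
        continuous_on_cost_opt_vel d_continuous continuous_on_perspective_conj)
  have "integral {t..T} gap = integral {t..T} (\<lambda>r. perspective_conj q (d t r))
      - (integral {t..T} (\<lambda>r. q \<bullet> opt_vel p t r) - integral {t..T} (\<lambda>r. d t r * \<l> (opt_vel p t r)))"
    unfolding gap_def integral_diff[OF integrable(2,3), symmetric]
    by (rule integral_diff) (intro integrable_diff integrable)+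
  also have "\<dots> = path_cost p - path_cost q
      - d t T * (\<gamma> (endpoint p) - \<gamma> (endpoint q)) - q \<bullet> (endpoint p - endpoint q)"
    using t_less
    by (simp add: path_cost_conj[of q] path_cost_def[of p] endpoint_def inner_integral_opt_vel algebra_simps)
  also have "\<dots> \<le> 0"
  proof -
    have "d t T * (grad \<gamma> (endpoint q) \<bullet> (endpoint p - endpoint q)) \<le> d t T * (\<gamma> (endpoint p) - \<gamma> (endpoint q))"
      using endpoint_cost_tangent[of "endpoint q" "endpoint p"] d_bounds(2)[of t T] t_less
      by (intro mult_left_mono) auto
    moreover have "d t T * (grad \<gamma> (endpoint q) \<bullet> (endpoint p - endpoint q)) = - (q \<bullet> (endpoint p - endpoint q))"
      by (subst (3) q) simp
    ultimately show ?thesis using min[of q] by linarith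
  qed
  finally have "integral {t..T} gap = 0"
    using integral_nonneg[OF integrable_continuous_real[OF cont] nonneg] by linarith
  then have "gap t = 0"
    using integral_eq_0_iff[OF cont t_less nonneg] t_less by auto
  then have "opt_vel p t t = vel ((1 / d t t) *\<^sub>R q)"
    using fenchel_young_eq_iff[of "d t t" q "opt_vel p t t"] d_start by (simp add: gap_def)
  then have "vel p = vel q" by (simp add: opt_vel_def d_start)
  then have "p = q" by (metis grad_vel)
  with q show ?thesis by simp
qed

end

section \<open>Upper and lower bounds for the scalar value\<close>

locale optimal_momentum = discounted_control \<l> \<gamma> d d' T a t x
  for \<l> \<gamma> :: "'b::euclidean_space \<Rightarrow> real" and d d' :: "real \<Rightarrow> real \<Rightarrow> real" and T a t :: real and x :: 'b +
  fixes p :: 'b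
  assumes stationary: "p = - (d t T *\<^sub>R grad \<gamma> (endpoint p))"
begin

text \<open>The optimal endpoint at time \<open>t\<close> and the slope of the terminal cost there. Both stay fixed while
  the starting time moves.\<close>

abbreviation "z0 \<equiv> endpoint p"
abbreviation "n0 \<equiv> grad \<gamma> z0"

text \<open>The momentum that the transversality condition prescribes for starting time \<open>\<tau>\<close> if the endpoint
  is kept at \<open>z0\<close>.\<close>

definition momentum :: "real \<Rightarrow> 'b" where
  "momentum \<tau> = - (d \<tau> T *\<^sub>R n0)"

lemma momentum_t [simp]: "momentum t = p"
  using stationary by (simp add: momentum_def)

definition shifted_endpoint :: "real \<Rightarrow> 'b" where
  "shifted_endpoint \<tau> = x + integral {\<tau>..T} (opt_vel p t)"

text \<open>The cost, for starting time \<open>\<tau>\<close>, of using on \<open>{\<tau>..T}\<close> the velocities that are optimal for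
  \<open>t\<close>.\<close>

definition upper_bound :: "real \<Rightarrow> real" where
  "upper_bound \<tau> = integral {\<tau>..T} (\<lambda>r. d \<tau> r * \<l> (opt_vel p t r)) + d \<tau> T * \<gamma> (shifted_endpoint \<tau>)"

text \<open>The natural dual bound is
  \<open>momentum \<tau> \<bullet> (z0 - x) - \<integral> perspective_conj (momentum \<tau>) (d \<tau> r) dr + d \<tau> T * \<gamma> z0\<close>.
  Its increment from \<open>t\<close> to \<open>\<tau>\<close> contains the increment of the conjugate, which is estimated here by
  testing the conjugate at time \<open>t\<close> with the maximiser for \<open>\<tau>\<close>. The resulting function is explicit in the
  increments of \<open>d\<close>, so that its right derivative needs the continuity of \<open>vel\<close>, but no
  derivative of the conjugate.\<close>

definition lower_bound :: "real \<Rightarrow> real" where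
  "lower_bound \<tau> = path_cost p + (momentum \<tau> - p) \<bullet> (z0 - x)
     + integral {t..\<tau>} (\<lambda>r. perspective_conj p (d t r))
     + integral {\<tau>..T} (\<lambda>r. (d \<tau> r - d t r) * \<l> (opt_vel (momentum \<tau>) \<tau> r)
         - (momentum \<tau> - p) \<bullet> opt_vel (momentum \<tau>) \<tau> r)
     + (d \<tau> T - d t T) * \<gamma> z0"

definition time_slope :: real where
  "time_slope = perspective_conj p 1 + integral {t..T} (\<lambda>r. d' t r * \<l> (opt_vel p t r)) + d' t T * \<gamma> z0"

lemma upper_bound_t: "upper_bound t = path_cost p"
  by (simp add: upper_bound_def path_cost_def shifted_endpoint_def endpoint_def)

lemma lower_bound_t: "lower_bound t = path_cost p"
  by (simp add: lower_bound_def)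

lemma opt_vel_subinterval:
  assumes "t \<le> \<tau>"
  shows "continuous_on {\<tau>..T} (opt_vel q t)" "continuous_on {\<tau>..T} (\<lambda>r. \<l> (opt_vel q t r))"
    "continuous_on {\<tau>..T} (d t)" "continuous_on {\<tau>..T} (\<lambda>r. perspective_conj q (d t r))"
  using t_less assms
  by (auto intro!: continuous_on_subset[OF continuous_on_opt_vel[of t q]]
      continuous_on_subset[OF continuous_on_cost_opt_vel[of t q]]
      continuous_on_subset[OF d_continuous[of t]]
      continuous_on_subset[OF continuous_on_perspective_conj[of t q]])

lemma shifted_endpoint_eq:
  assumes "t \<le> \<tau>" "\<tau> \<le> T"
  shows "shifted_endpoint \<tau> = z0 - integral {t..\<tau>} (opt_vel p t)"
  using Henstock_Kurzweil_Integration.integral_combine[OF assms integrable_continuous_real[OF opt_vel_subinterval(1)[of t]], of p]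
  by (simp add: shifted_endpoint_def endpoint_def algebra_simps)

lemma lower_bound_conj:
  assumes "t \<le> \<tau>" "\<tau> \<le> T"
  shows "lower_bound \<tau> \<le> momentum \<tau> \<bullet> (z0 - x)
    - integral {\<tau>..T} (\<lambda>r. perspective_conj (momentum \<tau>) (d \<tau> r)) + d \<tau> T * \<gamma> z0"
proof -
  let ?w = "opt_vel (momentum \<tau>) \<tau>"
  have "integral {t..\<tau>} (\<lambda>r. perspective_conj p (d t r)) + integral {\<tau>..T} (\<lambda>r. perspective_conj p (d t r))
      = integral {t..T} (\<lambda>r. perspective_conj p (d t r))"
    by (intro Henstock_Kurzweil_Integration.integral_combine assms integrable_continuous_real opt_vel_subinterval(4)) simp
  moreover have "integral {\<tau>..T} (\<lambda>r. (d \<tau> r - d t r) * \<l> (?w r) - (momentum \<tau> - p) \<bullet> ?w r)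
      \<le> integral {\<tau>..T} (\<lambda>r. perspective_conj p (d t r) - perspective_conj (momentum \<tau>) (d \<tau> r))"
  proof (rule integral_le)
    fix r assume r: "r \<in> {\<tau>..T}"
    have "p \<bullet> ?w r - d t r * \<l> (?w r) \<le> perspective_conj p (d t r)"
      using r assms by (intro fenchel_young d_bounds) auto
    then show "(d \<tau> r - d t r) * \<l> (?w r) - (momentum \<tau> - p) \<bullet> ?w r
        \<le> perspective_conj p (d t r) - perspective_conj (momentum \<tau>) (d \<tau> r)"
      by (simp add: perspective_conj_opt_vel[of "momentum \<tau>"] algebra_simps)
  qed (intro integrable_continuous_real continuous_intros continuous_on_opt_vel opt_vel_subinterval
      continuous_on_cost_opt_vel d_continuous continuous_on_perspective_conj assms)+
  moreover have "\<dots> = integral {\<tau>..T} (\<lambda>r. perspective_conj p (d t r))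
      - integral {\<tau>..T} (\<lambda>r. perspective_conj (momentum \<tau>) (d \<tau> r))"
    by (intro integral_diff integrable_continuous_real opt_vel_subinterval continuous_on_perspective_conj assms)
  ultimately show ?thesis
    unfolding lower_bound_def path_cost_conj by (simp add: algebra_simps)
qed

text \<open>Here \<open>f\<close> stands for the \<open>\<zeta>\<close>-component of a selection of the running cost, which may exceed the
  cost itself by the component of an element of the cone. Fenchel--Young with \<open>momentum \<tau>\<close> leaves only
  \<open>momentum \<tau> \<bullet> \<integral> v\<close>, and the tangent of \<open>\<gamma>\<close> at \<open>z0\<close> contributes the same quantity with the
  opposite sign.\<close>

lemma lower_bound_le_cost:
  assumes \<tau>: "t \<le> \<tau>" "\<tau> \<le> T"
    and v: "set_integrable lebesgue {\<tau>..T} v" and f: "set_integrable lebesgue {\<tau>..T} f"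
    and le: "AE r\<in>{\<tau>..T} in lebesgue. d \<tau> r * \<l> (v r) \<le> f r"
  shows "lower_bound \<tau> \<le> (LINT r:{\<tau>..T}|lebesgue. f r) + d \<tau> T * \<gamma> (x + (LINT r:{\<tau>..T}|lebesgue. v r))"
proof -
  let ?P = "momentum \<tau>" and ?V = "LINT r:{\<tau>..T}|lebesgue. v r"
  note Pv = set_integral_inner[OF v, of ?P]
  have N: "set_integrable lebesgue {\<tau>..T} (\<lambda>r. perspective_conj ?P (d \<tau> r))"
    by (intro absolutely_integrable_continuous_real continuous_on_perspective_conj \<tau>)
  have "(LINT r:{\<tau>..T}|lebesgue. ?P \<bullet> v r - perspective_conj ?P (d \<tau> r)) \<le> (LINT r:{\<tau>..T}|lebesgue. f r)"
  proof (rule set_integral_mono_AE)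
    show "AE r\<in>{\<tau>..T} in lebesgue. ?P \<bullet> v r - perspective_conj ?P (d \<tau> r) \<le> f r"
      using le
    proof eventually_elim
      case (elim r)
      then show ?case
        using fenchel_young[OF d_bounds(2)[of \<tau> r], of ?P "v r"] \<tau> by auto
    qed
  qed (intro set_integral_diff Pv N f)+
  then have "?P \<bullet> ?V - integral {\<tau>..T} (\<lambda>r. perspective_conj ?P (d \<tau> r)) \<le> (LINT r:{\<tau>..T}|lebesgue. f r)"
    using Pv N by (simp add: set_integral_diff set_lebesgue_integral_eq_integral)
  moreover have "d \<tau> T * (\<gamma> z0 + n0 \<bullet> (x + ?V - z0)) \<le> d \<tau> T * \<gamma> (x + ?V)"
    using d_bounds(2)[of \<tau> T] \<tau> by (intro mult_left_mono endpoint_cost_tangent) auto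
  moreover have "d \<tau> T * (n0 \<bullet> (x + ?V - z0)) = - (?P \<bullet> (x + ?V - z0))"
    by (simp add: momentum_def)
  ultimately show ?thesis
    using lower_bound_conj[OF \<tau>] by (simp add: algebra_simps)
qed

lemma initial_average_LIMSEQ:
  assumes "continuous_on {t..T} \<phi>" "\<And>m. \<sigma> m \<in> {0<..T - t}" "\<sigma> \<longlonglongrightarrow> 0"
  shows "(\<lambda>m. integral {t..t + \<sigma> m} \<phi> / \<sigma> m) \<longlonglongrightarrow> (\<phi> t :: real)"
proof -
  have "((\<lambda>u. integral {t..u} \<phi>) has_real_derivative \<phi> t) (at t within {t..T})"
    using t_less by (intro integral_has_real_derivative assms) auto
  then show ?thesis
    using difference_quotient_LIMSEQ[of "\<lambda>u. integral {t..u} \<phi>", OF _ t_less] assms by auto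
qed

text \<open>Three effects of a later start add up: the discount factors change, the running cost on
  \<open>{t..\<tau>}\<close> is saved, and the endpoint moves back by \<open>\<integral> opt_vel p t\<close> over \<open>{t..\<tau>}\<close>. By stationarity the last
  two combine to \<open>p \<bullet> w - \<l> w\<close> at the initial velocity \<open>w = vel p\<close>, which is the conjugate at \<open>p\<close>.\<close>

lemma upper_bound_quotient_LIMSEQ:
  assumes \<sigma>: "\<And>m. \<sigma> m \<in> {0<..T - t}" "\<sigma> \<longlonglongrightarrow> 0"
  shows "(\<lambda>m. (upper_bound (t + \<sigma> m) - upper_bound t) / \<sigma> m) \<longlonglongrightarrow> time_slope"
proof -
  let ?V = "opt_vel p t"
  have \<sigma>': "0 < \<sigma> m" "t \<le> t + \<sigma> m" "t + \<sigma> m \<le> T" "\<sigma> m \<noteq> 0" for m using \<sigma>(1)[of m] by auto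
  obtain M where M: "0 \<le> M"
    "\<And>\<tau> s. t \<le> \<tau> \<Longrightarrow> \<tau> \<le> s \<Longrightarrow> s \<le> T \<Longrightarrow> \<bar>d \<tau> s - d t s\<bar> \<le> M * (\<tau> - t)"
    by (rule d_lipschitz, rule that)
  have "bounded ((\<lambda>r. \<l> (?V r)) ` {t..T})"
    by (intro compact_imp_bounded compact_continuous_image opt_vel_subinterval) auto
  then obtain K where K: "\<And>r. r \<in> {t..T} \<Longrightarrow> \<bar>\<l> (?V r)\<bar> \<le> K"
    unfolding bounded_iff by (metis imageI real_norm_def)
  define h where "h m r = (d (t + \<sigma> m) r - d t r) / \<sigma> m * \<l> (?V r)" for m r
  have run: "(\<lambda>m. integral {t + \<sigma> m..T} (h m)) \<longlonglongrightarrow> integral {t..T} (\<lambda>r. d' t r * \<l> (?V r))"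
  proof (rule integral_shrinking_interval_LIMSEQ[OF \<sigma>])
    show "h m integrable_on {t + \<sigma> m..T}" for m
      unfolding h_def using \<sigma>'[of m]
      by (intro integrable_continuous_real continuous_intros d_continuous opt_vel_subinterval) auto
    show "\<bar>h m r\<bar> \<le> M * K" if "r \<in> {t + \<sigma> m..T}" for m r
      unfolding h_def abs_mult abs_divide
      using M K[of r] M(2)[of "t + \<sigma> m" r] \<sigma>'[of m] that
      by (intro mult_mono) (auto simp: divide_le_eq)
    show "(\<lambda>m. h m r) \<longlonglongrightarrow> d' t r * \<l> (?V r)" if "t < r" "r \<le> T" for r
      unfolding h_def by (intro tendsto_intros d_quotient_LIMSEQ \<sigma> that)
  qed
  have start: "(\<lambda>m. integral {t..t + \<sigma> m} (\<lambda>r. d t r * \<l> (?V r)) / \<sigma> m) \<longlonglongrightarrow> d t t * \<l> (?V t)"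
    by (intro initial_average_LIMSEQ \<sigma> continuous_intros opt_vel_subinterval) auto
  \<comment> \<open>The endpoint as a function of the starting time, and the chain rule for \<open>\<gamma>\<close> along it.\<close>
  define e where "e \<tau> = z0 - integral {t..\<tau>} ?V" for \<tau>
  have "(e has_vector_derivative - ?V t) (at t within {t..T})"
    unfolding e_def using t_less
    by (auto intro!: derivative_eq_intros integral_has_vector_derivative opt_vel_subinterval)
  then have e_deriv: "(e has_derivative (\<lambda>h. h *\<^sub>R - ?V t)) (at t within {t..T})"
    by (simp add: has_vector_derivative_def)
  have "(\<gamma> has_derivative (\<lambda>h. h \<bullet> n0)) (at (e t))"
    using C2_GDERIV[OF \<gamma>_C2, of z0] by (simp add: gderiv_def e_def)
  from has_derivative_compose[OF e_deriv this]
  have "((\<lambda>\<tau>. \<gamma> (e \<tau>)) has_derivative (\<lambda>h. h *\<^sub>R - ?V t \<bullet> n0)) (at t within {t..T})" .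
  moreover have "(\<lambda>h. h *\<^sub>R - ?V t \<bullet> n0) = (*) (- (n0 \<bullet> ?V t))"
    by (simp add: fun_eq_iff inner_commute)
  ultimately have \<gamma>e: "((\<lambda>\<tau>. \<gamma> (e \<tau>)) has_real_derivative - (n0 \<bullet> ?V t)) (at t within {t..T})"
    by (simp add: has_field_derivative_def)
  have terminal: "(\<lambda>m. (\<gamma> (e (t + \<sigma> m)) - \<gamma> (e t)) / \<sigma> m) \<longlonglongrightarrow> - (n0 \<bullet> ?V t)"
    by (intro difference_quotient_LIMSEQ[OF \<gamma>e t_less] \<sigma>' \<sigma>(2))
  then have "(\<lambda>m. (\<gamma> (e (t + \<sigma> m)) - \<gamma> (e t)) / \<sigma> m * \<sigma> m + \<gamma> (e t)) \<longlonglongrightarrow> - (n0 \<bullet> ?V t) * 0 + \<gamma> (e t)"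
    by (intro tendsto_intros \<sigma>(2))
  then have terminal_value: "(\<lambda>m. \<gamma> (e (t + \<sigma> m))) \<longlonglongrightarrow> \<gamma> z0"
    using \<sigma>'(4) by (simp add: e_def)
  have split: "(upper_bound (t + \<sigma> m) - upper_bound t) / \<sigma> m =
      integral {t + \<sigma> m..T} (h m) - integral {t..t + \<sigma> m} (\<lambda>r. d t r * \<l> (?V r)) / \<sigma> m
      + (d (t + \<sigma> m) T - d t T) / \<sigma> m * \<gamma> (e (t + \<sigma> m))
      + d t T * ((\<gamma> (e (t + \<sigma> m)) - \<gamma> (e t)) / \<sigma> m)" for m
  proof -
    let ?\<tau> = "t + \<sigma> m"
    have i: "(\<lambda>r. d ?\<tau> r * \<l> (?V r)) integrable_on {?\<tau>..T}" "(\<lambda>r. d t r * \<l> (?V r)) integrable_on {?\<tau>..T}"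
      "(\<lambda>r. d t r * \<l> (?V r)) integrable_on {t..T}"
      using \<sigma>'[of m]
      by (auto intro!: integrable_continuous_real continuous_intros d_continuous opt_vel_subinterval)
    \<comment> \<open>The integral at time \<open>t\<close> is split at \<open>\<tau>\<close>, so that only the change of the discount factor remains on \<open>{\<tau>..T}\<close>.\<close>
    have "integral {?\<tau>..T} (h m) = integral {?\<tau>..T} (\<lambda>r. (d ?\<tau> r * \<l> (?V r) - d t r * \<l> (?V r)) / \<sigma> m)"
      unfolding h_def by (simp add: algebra_simps diff_divide_distrib)
    also have "\<dots> = (integral {?\<tau>..T} (\<lambda>r. d ?\<tau> r * \<l> (?V r)) - integral {?\<tau>..T} (\<lambda>r. d t r * \<l> (?V r))) / \<sigma> m"
      using i by (simp add: integral_diff)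
    also have "integral {?\<tau>..T} (\<lambda>r. d t r * \<l> (?V r)) =
        integral {t..T} (\<lambda>r. d t r * \<l> (?V r)) - integral {t..?\<tau>} (\<lambda>r. d t r * \<l> (?V r))"
      using Henstock_Kurzweil_Integration.integral_combine[OF \<sigma>'(2,3) i(3), of m] by simp
    finally have "integral {?\<tau>..T} (h m) - integral {t..?\<tau>} (\<lambda>r. d t r * \<l> (?V r)) / \<sigma> m =
      (integral {?\<tau>..T} (\<lambda>r. d ?\<tau> r * \<l> (?V r)) - integral {t..T} (\<lambda>r. d t r * \<l> (?V r))) / \<sigma> m"
      by (simp add: diff_divide_distrib)
    moreover have "shifted_endpoint ?\<tau> = e ?\<tau>" "shifted_endpoint t = e t"
      using \<sigma>'[of m] t_less by (auto simp: e_def shifted_endpoint_eq)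
    ultimately show ?thesis
      unfolding upper_bound_def by (simp add: diff_divide_distrib add_divide_distrib algebra_simps)
  qed
  have "(\<lambda>m. (upper_bound (t + \<sigma> m) - upper_bound t) / \<sigma> m) \<longlonglongrightarrow>
      integral {t..T} (\<lambda>r. d' t r * \<l> (?V r)) - d t t * \<l> (?V t) + d' t T * \<gamma> z0
      + d t T * (- (n0 \<bullet> ?V t))"
    unfolding split using t_less
    by (intro tendsto_intros run start terminal terminal_value d_quotient_LIMSEQ \<sigma>) auto
  moreover have "p \<bullet> ?V t = d t T * (- (n0 \<bullet> ?V t))"
    by (subst stationary) simp
  then have "perspective_conj p 1 = d t T * (- (n0 \<bullet> ?V t)) - \<l> (?V t)"
    using perspective_conj_opt_vel[of p t t] d_start by simp
  then have "integral {t..T} (\<lambda>r. d' t r * \<l> (?V r)) - d t t * \<l> (?V t) + d' t T * \<gamma> z0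
      + d t T * (- (n0 \<bullet> ?V t)) = time_slope"
    by (simp add: time_slope_def d_start)
  ultimately show ?thesis by simp
qed

text \<open>The integrands converge because \<open>vel\<close> is continuous, and they are dominated because all
  momenta \<open>momentum \<tau> / d \<tau> r\<close> lie in one ball. In the limit the term from the change of the momentum,
  \<open>- d' t T * (n0 \<bullet> (z0 - x))\<close>, cancels against the integral of \<open>d' t T * (n0 \<bullet> opt_vel p t r)\<close>.\<close>

lemma lower_bound_quotient_LIMSEQ:
  assumes \<sigma>: "\<And>m. \<sigma> m \<in> {0<..T - t}" "\<sigma> \<longlonglongrightarrow> 0"
  shows "(\<lambda>m. (lower_bound (t + \<sigma> m) - lower_bound t) / \<sigma> m) \<longlonglongrightarrow> time_slope"
proof -
  let ?V = "opt_vel p t"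
  have \<sigma>': "0 < \<sigma> m" "t \<le> t + \<sigma> m" "t + \<sigma> m \<le> T" "\<sigma> m \<noteq> 0" for m using \<sigma>(1)[of m] by auto
  define W where "W m = opt_vel (momentum (t + \<sigma> m)) (t + \<sigma> m)" for m
  define k where "k m r = (d (t + \<sigma> m) r - d t r) / \<sigma> m" for m r
  have k_lim: "(\<lambda>m. k m r) \<longlonglongrightarrow> d' t r" if "t < r" "r \<le> T" for r
    unfolding k_def by (intro d_quotient_LIMSEQ \<sigma> that)
  obtain M where M: "0 \<le> M"
    "\<And>\<tau> s. t \<le> \<tau> \<Longrightarrow> \<tau> \<le> s \<Longrightarrow> s \<le> T \<Longrightarrow> \<bar>d \<tau> s - d t s\<bar> \<le> M * (\<tau> - t)"
    by (rule d_lipschitz, rule that)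
  have k_bound: "\<bar>k m r\<bar> \<le> M" if "r \<in> {t + \<sigma> m..T}" for m r
    unfolding k_def abs_divide using M(2)[of "t + \<sigma> m" r] \<sigma>'[of m] that by (auto simp: divide_le_eq)
  have \<sigma>k: "\<sigma> m * k m r = d (t + \<sigma> m) r - d t r" for m r
    using \<sigma>'(4)[of m] by (simp add: k_def)
  \<comment> \<open>The change of the momentum is caused by the discount of the terminal cost alone.\<close>
  have mom: "momentum (t + \<sigma> m) - p = - ((\<sigma> m * k m T) *\<^sub>R n0)" for m
    by (subst (2) stationary) (simp add: \<sigma>k momentum_def scaleR_left_diff_distrib)
  \<comment> \<open>One compact set of velocities serves all \<open>m\<close> and \<open>r\<close>, since \<open>a < d \<tau> r\<close> and \<open>d \<tau> T \<le> 1\<close>.\<close>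
  define B where "B = vel ` cball 0 (norm n0 / a)"
  have "compact B"
    unfolding B_def by (intro compact_continuous_image continuous_on_vel) auto
  then have "bounded B" "bounded (\<l> ` B)"
    by (auto intro!: compact_imp_bounded compact_continuous_image C2_continuous_on smooth)
  then obtain R K where R: "\<And>w. w \<in> B \<Longrightarrow> norm w \<le> R" and K: "\<And>w. w \<in> B \<Longrightarrow> \<bar>\<l> w\<bar> \<le> K"
    unfolding bounded_iff by (metis imageI real_norm_def)
  have W_B: "W m r \<in> B" if "r \<in> {t + \<sigma> m..T}" for m r
  proof -
    have dd: "a < d (t + \<sigma> m) r" "0 < d (t + \<sigma> m) T" "d (t + \<sigma> m) T \<le> 1"
      using that \<sigma>'[of m] by (auto intro: d_bounds)
    then have "norm ((1 / d (t + \<sigma> m) r) *\<^sub>R momentum (t + \<sigma> m)) = d (t + \<sigma> m) T * norm n0 / d (t + \<sigma> m) r"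
      using a_pos by (simp add: momentum_def)
    also have "\<dots> \<le> norm n0 / a"
      using a_pos dd by (intro frac_le mult_left_le_one_le) auto
    finally have "norm ((1 / d (t + \<sigma> m) r) *\<^sub>R momentum (t + \<sigma> m)) \<le> norm n0 / a" .
    then show ?thesis unfolding W_def opt_vel_def B_def by auto
  qed
  have W_lim: "(\<lambda>m. W m r) \<longlonglongrightarrow> ?V r" if r: "t < r" "r \<le> T" for r
    unfolding W_def opt_vel_def
  proof (rule isCont_tendsto_compose[of _ vel])
    show "isCont vel ((1 / d t r) *\<^sub>R p)"
      using continuous_on_vel[of UNIV] by (simp add: continuous_on_eq_continuous_at)
    have "(\<lambda>m. momentum (t + \<sigma> m)) \<longlonglongrightarrow> momentum t"
      unfolding momentum_def using t_less by (intro tendsto_intros d_LIMSEQ \<sigma>) auto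
    moreover have "d t r \<noteq> 0" using d_bounds(2)[of t r] r by auto
    ultimately show "(\<lambda>m. (1 / d (t + \<sigma> m) r) *\<^sub>R momentum (t + \<sigma> m)) \<longlonglongrightarrow> (1 / d t r) *\<^sub>R p"
      by (intro tendsto_intros d_LIMSEQ \<sigma> r) auto
  qed
  define h where "h m r = k m r * \<l> (W m r) + k m T * (n0 \<bullet> W m r)" for m r
  have run: "(\<lambda>m. integral {t + \<sigma> m..T} (h m)) \<longlonglongrightarrow>
      integral {t..T} (\<lambda>r. d' t r * \<l> (?V r) + d' t T * (n0 \<bullet> ?V r))"
  proof (rule integral_shrinking_interval_LIMSEQ[OF \<sigma>])
    show "h m integrable_on {t + \<sigma> m..T}" for m
      unfolding h_def k_def W_def using \<sigma>'[of m]
      by (intro integrable_continuous_real continuous_intros d_continuous opt_vel_subinterval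
          continuous_on_opt_vel continuous_on_cost_opt_vel) auto
    show "\<bar>h m r\<bar> \<le> M * K + M * (norm n0 * R)" if r: "r \<in> {t + \<sigma> m..T}" for m r
    proof -
      have "\<bar>k m r * \<l> (W m r)\<bar> \<le> M * K"
        unfolding abs_mult using k_bound[OF r] K[OF W_B[OF r]] M(1) by (intro mult_mono) auto
      moreover have "\<bar>n0 \<bullet> W m r\<bar> \<le> norm n0 * R"
        using Cauchy_Schwarz_ineq2[of n0 "W m r"] R[OF W_B[OF r]]
        by (meson mult_left_mono norm_ge_zero order_trans)
      then have "\<bar>k m T * (n0 \<bullet> W m r)\<bar> \<le> M * (norm n0 * R)"
        unfolding abs_mult using k_bound[of T m] \<sigma>'[of m] M(1) by (intro mult_mono) auto
      ultimately show ?thesis unfolding h_def by linarith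
    qed
    show "(\<lambda>m. h m r) \<longlonglongrightarrow> d' t r * \<l> (?V r) + d' t T * (n0 \<bullet> ?V r)" if r: "t < r" "r \<le> T" for r
    proof -
      have "isCont \<l> (?V r)"
        using C2_continuous_on[OF smooth, of UNIV] by (simp add: continuous_on_eq_continuous_at)
      then have "(\<lambda>m. \<l> (W m r)) \<longlonglongrightarrow> \<l> (?V r)" by (rule isCont_tendsto_compose[OF _ W_lim[OF r]])
      then show ?thesis
        unfolding h_def using t_less by (intro tendsto_intros k_lim W_lim r) auto
    qed
  qed
  have start: "(\<lambda>m. integral {t..t + \<sigma> m} (\<lambda>r. perspective_conj p (d t r)) / \<sigma> m)
      \<longlonglongrightarrow> perspective_conj p (d t t)"
    by (intro initial_average_LIMSEQ \<sigma> opt_vel_subinterval) auto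
  have split: "(lower_bound (t + \<sigma> m) - lower_bound t) / \<sigma> m =
      - (k m T * (n0 \<bullet> (z0 - x))) + integral {t..t + \<sigma> m} (\<lambda>r. perspective_conj p (d t r)) / \<sigma> m
      + integral {t + \<sigma> m..T} (h m) + k m T * \<gamma> z0" for m
  proof -
    let ?\<tau> = "t + \<sigma> m"
    have "integral {?\<tau>..T} (\<lambda>r. (d ?\<tau> r - d t r) * \<l> (W m r) - (momentum ?\<tau> - p) \<bullet> W m r)
        = integral {?\<tau>..T} (\<lambda>r. \<sigma> m * h m r)"
      unfolding mom h_def \<sigma>k[symmetric] by (simp add: algebra_simps)
    then have "lower_bound ?\<tau> - lower_bound t = - (\<sigma> m * k m T * (n0 \<bullet> (z0 - x)))
      + integral {t..?\<tau>} (\<lambda>r. perspective_conj p (d t r))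
      + \<sigma> m * integral {?\<tau>..T} (h m) + \<sigma> m * k m T * \<gamma> z0"
      unfolding lower_bound_t unfolding lower_bound_def mom W_def \<sigma>k by simp
    then show ?thesis using \<sigma>'(4)[of m] by (simp add: field_simps)
  qed
  have "(\<lambda>m. (lower_bound (t + \<sigma> m) - lower_bound t) / \<sigma> m) \<longlonglongrightarrow>
      - (d' t T * (n0 \<bullet> (z0 - x))) + perspective_conj p (d t t)
      + integral {t..T} (\<lambda>r. d' t r * \<l> (?V r) + d' t T * (n0 \<bullet> ?V r)) + d' t T * \<gamma> z0"
    unfolding split using t_less by (intro tendsto_intros run start k_lim) auto
  moreover have "integral {t..T} (\<lambda>r. d' t r * \<l> (?V r) + d' t T * (n0 \<bullet> ?V r)) =
      integral {t..T} (\<lambda>r. d' t r * \<l> (?V r)) + d' t T * (n0 \<bullet> (z0 - x))"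
  proof -
    have "integral {t..T} (\<lambda>r. d' t r * \<l> (?V r) + d' t T * (n0 \<bullet> ?V r)) =
      integral {t..T} (\<lambda>r. d' t r * \<l> (?V r)) + integral {t..T} (\<lambda>r. d' t T * (n0 \<bullet> ?V r))"
      by (intro integral_add integrable_continuous_real continuous_intros opt_vel_subinterval continuous_on_d'_start) auto
    then show ?thesis
      using t_less by (simp add: endpoint_def inner_integral_opt_vel)
  qed
  ultimately show ?thesis by (simp add: time_slope_def d_start algebra_simps)
qed

end

section \<open>The set-valued problem\<close>

lemma set_integral_cong_AE_integrable:
  fixes f g :: "'a \<Rightarrow> 'b::{banach, second_countable_topology}"
  assumes "set_integrable M A f" "set_integrable M A g" "AE r\<in>A in M. f r = g r"
  shows "(LINT r:A|M. f r) = (LINT r:A|M. g r)"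
  unfolding set_lebesgue_integral_def
proof (rule integral_cong_AE)
  show "AE r in M. indicat_real A r *\<^sub>R f r = indicat_real A r *\<^sub>R g r"
    using assms(3) by eventually_elim (simp split: split_indicator)
qed (use assms(1,2) in \<open>auto simp: set_integrable_def\<close>)

lemma set_integrable_continuous_scaleR:
  fixes f :: "real \<Rightarrow> 'a::euclidean_space"
  assumes "continuous_on {a..b} c" "set_integrable lebesgue {a..b} f"
  shows "set_integrable lebesgue {a..b} (\<lambda>s. c s *\<^sub>R f s)"
proof -
  have "c \<in> borel_measurable (lebesgue_on {a..b})"
    using assms(1) by (intro continuous_imp_measurable_on_sets_lebesgue) auto
  moreover have "bounded (c ` {a..b})"
    using assms(1) by (intro compact_imp_bounded compact_continuous_image) auto
  moreover have "bilinear ((*\<^sub>R) :: real \<Rightarrow> 'a \<Rightarrow> 'a)"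
    using bilinear_conv_bounded_bilinear bounded_bilinear_scaleR by blast
  ultimately show ?thesis
    using absolutely_integrable_bounded_measurable_product[of "(*\<^sub>R)" c "{a..b}" f] assms(2) by simp
qed

lemma has_weak_deriv_primitive:
  fixes v :: "real \<Rightarrow> 'b::euclidean_space"
  assumes "continuous_on {\<tau>..T} v"
  shows "has_weak_deriv (\<lambda>s. x + (LINT r:{\<tau>..s}|lebesgue. v r)) v \<tau> T"
    and "x + (LINT r:{\<tau>..\<tau>}|lebesgue. v r) = x"
proof -
  have "(LINT r:{\<tau>..\<tau>}|lebesgue. v r) = 0"
    using absolutely_integrable_continuous_real[of \<tau> \<tau> v]
    by (simp add: set_lebesgue_integral_eq_integral)
  then show "x + (LINT r:{\<tau>..\<tau>}|lebesgue. v r) = x" by simp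
  then show "has_weak_deriv (\<lambda>s. x + (LINT r:{\<tau>..s}|lebesgue. v r)) v \<tau> T"
    unfolding has_weak_deriv_def using assms by (simp add: absolutely_integrable_continuous_real)
qed

text \<open>The vector-valued data, seen through \<open>\<zeta>\<close>, form an instance of the scalar problem. The integrability
  assumption concerns all of \<open>L\<close>, of which only the \<open>\<zeta>\<close>-component is known to be continuous.\<close>

locale set_valued_control = discounted_control "\<lambda>w. L w \<bullet> \<zeta>" "\<lambda>w. g w \<bullet> \<zeta>" d d' T a t x
  for L g :: "'b::euclidean_space \<Rightarrow> 'a::euclidean_space" and \<zeta> :: 'a
    and d d' :: "real \<Rightarrow> real \<Rightarrow> real" and T a t :: real and x :: 'b +
  fixes C :: "'a set"
  assumes zero_in_C: "0 \<in> C" and \<zeta>_dual: "\<zeta> \<in> dual_cone C" and \<zeta>_nonzero: "\<zeta> \<noteq> 0"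
    and finite_cost: "\<And>q. set_integrable lebesgue {t..T}
      (\<lambda>s. d t s *\<^sub>R L (weak_deriv t T (Y_path L d t x q \<zeta>) s))"
begin

abbreviation Y :: "'b \<Rightarrow> real \<Rightarrow> 'b" where
  "Y q \<equiv> Y_path L d t x q \<zeta>"

lemma Y_eq: "Y q = (\<lambda>s. x + (LINT r:{t..s}|lebesgue. opt_vel q t r))"
  by (simp add: fun_eq_iff Y_path_def opt_vel_def)

lemma Y_T: "Y q T = endpoint q"
  unfolding Y_eq endpoint_def using t_less
  by (simp add: set_lebesgue_integral_eq_integral absolutely_integrable_continuous_real continuous_on_opt_vel)

lemma weak_deriv_Y_AE: "AE r\<in>{t..T} in lebesgue. weak_deriv t T (Y q) r = opt_vel q t r"
proof -
  have "has_weak_deriv (Y q) (opt_vel q t) t T"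
    unfolding Y_eq using t_less by (intro has_weak_deriv_primitive continuous_on_opt_vel) auto
  from has_weak_deriv_unique_AE[OF has_weak_deriv_weak_deriv[OF this] this] show ?thesis .
qed

text \<open>Any continuous weight can replace \<open>d t\<close>, as \<open>d t\<close> is continuous and bounded away from \<open>0\<close>.\<close>

lemma integrable_weighted_cost:
  assumes "t \<le> \<tau>" "continuous_on {\<tau>..T} c"
  shows "set_integrable lebesgue {\<tau>..T} (\<lambda>s. c s *\<^sub>R L (weak_deriv t T (Y q) s))"
proof -
  let ?F = "\<lambda>s. d t s *\<^sub>R L (weak_deriv t T (Y q) s)"
  have pos: "d t s \<noteq> 0" if "s \<in> {\<tau>..T}" for s using d_bounds(2)[of t s] that assms(1) by auto
  have "set_integrable lebesgue {\<tau>..T} ?F"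
    by (rule set_integrable_subset[OF finite_cost]) (use assms(1) in auto)
  moreover have "continuous_on {\<tau>..T} (\<lambda>s. c s / d t s)"
    using pos assms t_less
    by (intro continuous_intros continuous_on_subset[OF d_continuous[of t]]) auto
  ultimately have "set_integrable lebesgue {\<tau>..T} (\<lambda>s. (c s / d t s) *\<^sub>R ?F s)"
    using set_integrable_continuous_scaleR by blast
  moreover have "set_integrable lebesgue {\<tau>..T} (\<lambda>s. (c s / d t s) *\<^sub>R ?F s) =
      set_integrable lebesgue {\<tau>..T} (\<lambda>s. c s *\<^sub>R L (weak_deriv t T (Y q) s))"
    by (rule set_integrable_cong) (use pos in auto)
  ultimately show ?thesis by simp
qed

lemma integral_weighted_cost:
  assumes "t \<le> \<tau>" "\<tau> \<le> T" "continuous_on {\<tau>..T} c"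
  shows "\<zeta> \<bullet> (LINT s:{\<tau>..T}|lebesgue. c s *\<^sub>R L (weak_deriv t T (Y q) s))
     = integral {\<tau>..T} (\<lambda>r. c r * (L (opt_vel q t r) \<bullet> \<zeta>))"
proof -
  let ?f = "\<lambda>s. c s *\<^sub>R L (weak_deriv t T (Y q) s)"
  have abs: "set_integrable lebesgue {\<tau>..T} (\<lambda>r. c r * (L (opt_vel q t r) \<bullet> \<zeta>))"
    using assms(1,2)
    by (intro absolutely_integrable_continuous_real continuous_intros assms
        continuous_on_subset[OF continuous_on_cost_opt_vel[of t q]]) auto
  have "\<zeta> \<bullet> (LINT s:{\<tau>..T}|lebesgue. ?f s) = (LINT s:{\<tau>..T}|lebesgue. \<zeta> \<bullet> ?f s)"
    using set_integral_inner(2)[OF integrable_weighted_cost[OF assms(1,3)]] by simp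
  also have "\<dots> = (LINT r:{\<tau>..T}|lebesgue. c r * (L (opt_vel q t r) \<bullet> \<zeta>))"
  proof (rule set_integral_cong_AE_integrable[OF set_integral_inner(1)[OF integrable_weighted_cost[OF assms(1,3)]] abs])
    show "AE r\<in>{\<tau>..T} in lebesgue. \<zeta> \<bullet> ?f r = c r * (L (opt_vel q t r) \<bullet> \<zeta>)"
      using weak_deriv_Y_AE[of q]
    proof eventually_elim
      case (elim r)
      then show ?case using assms(1) by (auto simp: inner_commute[of \<zeta>])
    qed
  qed
  finally show ?thesis using abs by (simp add: set_lebesgue_integral_eq_integral)
qed

lemma I_scal_Y: "I_scal L g d T t \<zeta> (Y q) = path_cost q"
proof -
  have "\<zeta> \<bullet> (LINT s:{t..T}|lebesgue. d t s *\<^sub>R L (weak_deriv t T (Y q) s))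
     = integral {t..T} (\<lambda>r. d t r * (L (opt_vel q t r) \<bullet> \<zeta>))"
    using t_less by (intro integral_weighted_cost d_continuous) auto
  then show ?thesis
    by (simp add: I_scal_def I_cost_def path_cost_def Y_T inner_add_left inner_commute[of \<zeta>])
qed

end

locale set_valued_optimum = set_valued_control L g \<zeta> d d' T a t x C
  for L g :: "'b::euclidean_space \<Rightarrow> 'a::euclidean_space" and \<zeta> :: 'a
    and d d' :: "real \<Rightarrow> real \<Rightarrow> real" and T a t :: real and x :: 'b and C :: "'a set" +
  fixes p :: 'b
  assumes optimal: "\<And>q. I_scal L g d T t \<zeta> (Y p) \<le> I_scal L g d T t \<zeta> (Y q)"
begin

sublocale optimal_momentum "\<lambda>w. L w \<bullet> \<zeta>" "\<lambda>w. g w \<bullet> \<zeta>" d d' T a t x p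
  by unfold_locales (rule minimal_momentum_stationary, use optimal in \<open>simp add: I_scal_Y\<close>)

text \<open>At \<open>\<tau> = T\<close> the Aumann integral is \<open>C\<close> by convention, and the scalar estimate is applied to integrals
  over a single point.\<close>

lemma J_cost_ge_lower_bound:
  assumes \<tau>: "t \<le> \<tau>" "\<tau> \<le> T" and y: "y \<in> admissible T \<tau> x" and z: "z \<in> J_cost C L g d T \<tau> y"
  shows "lower_bound \<tau> \<le> \<zeta> \<bullet> z"
proof (cases "\<tau> = T")
  case True
  obtain c where c: "c \<in> C" "z = d \<tau> T *\<^sub>R g (y T) + c"
    using z True by (auto simp: J_cost_def aumann_integral_def)
  have const: "set_integrable lebesgue {\<tau>..T} (\<lambda>_. u)" for u :: real
    by (intro absolutely_integrable_continuous_real continuous_intros)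
  have "lower_bound \<tau> \<le> (LINT r:{\<tau>..T}|lebesgue. d T T * (L 0 \<bullet> \<zeta>))
      + d \<tau> T * (g (x + (LINT r:{\<tau>..T}|lebesgue. (\<lambda>_. 0) r)) \<bullet> \<zeta>)"
    by (rule lower_bound_le_cost[OF \<tau>]) (use const True in auto)
  also have "(LINT r:{\<tau>..T}|lebesgue. d T T * (L 0 \<bullet> \<zeta>)) = 0"
    using const True by (subst set_lebesgue_integral_eq_integral) auto
  finally have "lower_bound \<tau> \<le> d \<tau> T * (g (y T) \<bullet> \<zeta>)"
    using y True by (simp add: admissible_def)
  moreover have "0 \<le> \<zeta> \<bullet> c" using c \<zeta>_dual by (auto simp: dual_cone_def)
  ultimately show ?thesis using c by (simp add: inner_add_right inner_commute[of \<zeta>])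
next
  case False
  let ?v = "weak_deriv \<tau> T y"
  have y': "y \<tau> = x" "has_weak_deriv y ?v \<tau> T"
    using y unfolding admissible_def W11_def by (blast intro: has_weak_deriv_weak_deriv)+
  have v: "set_integrable lebesgue {\<tau>..T} ?v" "y T = x + (LINT r:{\<tau>..T}|lebesgue. ?v r)"
  proof -
    have "\<forall>s\<in>{\<tau>..T}. y s = y \<tau> + (LINT r:{\<tau>..s}|lebesgue. ?v r)"
      using y'(2) unfolding has_weak_deriv_def by (rule conjunct2)
    from bspec[OF this, of T] show "y T = x + (LINT r:{\<tau>..T}|lebesgue. ?v r)"
      using \<tau> unfolding y'(1) by simp
    show "set_integrable lebesgue {\<tau>..T} ?v"
      using y'(2) unfolding has_weak_deriv_def by (rule conjunct1)
  qed
  obtain f where f: "set_integrable lebesgue {\<tau>..T} f"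
    "AE s\<in>{\<tau>..T} in lebesgue. f s \<in> running_cost C L d \<tau> s (?v s)"
    "z = d \<tau> T *\<^sub>R g (y T) + (LINT s:{\<tau>..T}|lebesgue. f s)"
    using z False by (auto simp: J_cost_def aumann_integral_def)
  have "lower_bound \<tau> \<le> (LINT r:{\<tau>..T}|lebesgue. \<zeta> \<bullet> f r)
      + d \<tau> T * (g (x + (LINT r:{\<tau>..T}|lebesgue. ?v r)) \<bullet> \<zeta>)"
  proof (rule lower_bound_le_cost[OF \<tau> v(1) set_integral_inner(1)[OF f(1)]])
    show "AE r\<in>{\<tau>..T} in lebesgue. d \<tau> r * (L (?v r) \<bullet> \<zeta>) \<le> \<zeta> \<bullet> f r"
      using f(2)
    proof eventually_elim
      case (elim r)
      then show ?case
        using \<zeta>_dual by (auto simp: running_cost_def dual_cone_def inner_add_left inner_commute[of \<zeta>])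
    qed
  qed
  then show ?thesis
    using set_integral_inner(2)[OF f(1), of \<zeta>] by (simp add: f(3) v(2) inner_add_right inner_commute[of \<zeta>])
qed

lemma value_fun_ge_lower_bound:
  assumes "t \<le> \<tau>" "\<tau> \<le> T" "z \<in> value_fun C L g d T \<tau> x"
  shows "lower_bound \<tau> \<le> \<zeta> \<bullet> z"
proof -
  have "value_fun C L g d T \<tau> x \<subseteq> {z. lower_bound \<tau> \<le> \<zeta> \<bullet> z}"
    unfolding value_fun_def lat_inf_def
    using J_cost_ge_lower_bound[OF assms(1,2)]
    by (intro closure_minimal closed_halfspace_ge) auto
  with assms(3) show ?thesis by auto
qed

text \<open>The path from \<open>x\<close> with velocity \<open>opt_vel p t\<close> on \<open>{\<tau>..T}\<close> has the running cost of \<open>Y p\<close>,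
  re-weighted from \<open>d t\<close> to \<open>d \<tau>\<close>, as an integrable selection.\<close>

lemma value_fun_attains_upper_bound:
  assumes \<tau>: "t \<le> \<tau>" "\<tau> \<le> T"
  shows "\<exists>z\<in>value_fun C L g d T \<tau> x. \<zeta> \<bullet> z \<le> upper_bound \<tau>"
proof -
  define y where "y s = x + (LINT r:{\<tau>..s}|lebesgue. opt_vel p t r)" for s
  have y: "has_weak_deriv y (opt_vel p t) \<tau> T" "y \<tau> = x"
    unfolding y_def [abs_def] by (rule has_weak_deriv_primitive opt_vel_subinterval \<tau>)+
  then have adm: "y \<in> admissible T \<tau> x" by (auto simp: admissible_def W11_def)
  have yT: "y T = shifted_endpoint \<tau>"
    unfolding y_def shifted_endpoint_def using \<tau>
    by (simp add: set_lebesgue_integral_eq_integral absolutely_integrable_continuous_real opt_vel_subinterval)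
  define f where "f r = d \<tau> r *\<^sub>R L (weak_deriv t T (Y p) r)" for r
  have f: "set_integrable lebesgue {\<tau>..T} f"
    unfolding f_def [abs_def] by (intro integrable_weighted_cost d_continuous \<tau>)
  have selection: "AE r\<in>{\<tau>..T} in lebesgue. f r \<in> running_cost C L d \<tau> r (weak_deriv \<tau> T y r)"
    using weak_deriv_Y_AE[of p] has_weak_deriv_unique_AE[OF has_weak_deriv_weak_deriv[OF y(1)] y(1)]
  proof eventually_elim
    case (elim r)
    show ?case
    proof
      assume "r \<in> {\<tau>..T}"
      with elim \<tau> have "weak_deriv t T (Y p) r = weak_deriv \<tau> T y r" by auto
      then show "f r \<in> running_cost C L d \<tau> r (weak_deriv \<tau> T y r)"
        unfolding f_def running_cost_def using zero_in_C by (intro image_eqI[of _ _ 0]) simp_all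
    qed
  qed
  have integral_f: "(LINT r:{\<tau>..T}|lebesgue. f r) \<in>
      aumann_integral C \<tau> T (\<lambda>s. running_cost C L d \<tau> s (weak_deriv \<tau> T y s))"
  proof (cases "\<tau> = T")
    case True
    have "(LINT r:{\<tau>..T}|lebesgue. f r) = integral {\<tau>..T} f"
      by (rule set_lebesgue_integral_eq_integral(2)[OF f])
    also have "\<dots> = 0" by (simp add: True)
    finally show ?thesis using zero_in_C by (simp add: aumann_integral_def True)
  next
    case False
    with f selection show ?thesis
      unfolding aumann_integral_def if_not_P[OF False] by (intro CollectI exI[of _ f] conjI refl)
  qed
  have "d \<tau> T *\<^sub>R g (y T) + (LINT r:{\<tau>..T}|lebesgue. f r) \<in> J_cost C L g d T \<tau> y"
    unfolding J_cost_def by (intro imageI integral_f)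
  then have "d \<tau> T *\<^sub>R g (y T) + (LINT r:{\<tau>..T}|lebesgue. f r) \<in> value_fun C L g d T \<tau> x"
    unfolding value_fun_def lat_inf_def by (intro subsetD[OF closure_subset] UN_I[OF adm])
  moreover have "\<zeta> \<bullet> (LINT r:{\<tau>..T}|lebesgue. f r) = integral {\<tau>..T} (\<lambda>r. d \<tau> r * (L (opt_vel p t r) \<bullet> \<zeta>))"
    unfolding f_def by (intro integral_weighted_cost d_continuous \<tau>)
  then have "\<zeta> \<bullet> (d \<tau> T *\<^sub>R g (y T) + (LINT r:{\<tau>..T}|lebesgue. f r)) = upper_bound \<tau>"
    by (simp add: upper_bound_def yT inner_add_right inner_commute[of \<zeta>])
  ultimately show ?thesis by (metis order_refl)
qed

lemma time_slope_eq: "time_slope = perspective_conj p 1 + \<zeta> \<bullet> w_fun L g d' T t (Y p)"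
proof -
  have "\<zeta> \<bullet> (LINT s:{t..T}|lebesgue. d' t s *\<^sub>R L (weak_deriv t T (Y p) s))
     = integral {t..T} (\<lambda>r. d' t r * (L (opt_vel p t r) \<bullet> \<zeta>))"
    using t_less by (intro integral_weighted_cost continuous_on_d'_start) auto
  then show ?thesis
    by (simp add: time_slope_def w_fun_def Y_T inner_add_right inner_commute[of \<zeta>])
qed

lemma fenchel_conj_running_cost:
  "fenchel_conj (running_cost C L d t t) p \<zeta> = {z. perspective_conj p 1 \<le> \<zeta> \<bullet> z}"
proof -
  have "running_cost C L d t t = (\<lambda>w. (+) (L w) ` C)"
    by (simp add: fun_eq_iff running_cost_def d_start)
  moreover have "fenchel_conj (\<lambda>w. (+) (L w) ` C) p \<zeta> =
      {z. p \<bullet> vel p - \<zeta> \<bullet> L (vel p) \<le> \<zeta> \<bullet> z}"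
    using fenchel_young[of 1 p]
    by (intro fenchel_conj_translated_cone \<zeta>_dual \<zeta>_nonzero zero_in_C)
      (simp add: perspective_conj_def inner_commute[of \<zeta>])
  ultimately show ?thesis by (simp add: perspective_conj_def inner_commute[of \<zeta>])
qed

theorem value_fun_has_time_deriv:
  "has_time_deriv (value_fun C L g d T) T \<zeta> t x
     ((+) (w_fun L g d' T t (Y p)) `
        fenchel_conj (running_cost C L d t t) (- (d t T *\<^sub>R grad (\<lambda>w. g w \<bullet> \<zeta>) (Y p T))) \<zeta>)"
proof -
  have "has_time_deriv (value_fun C L g d T) T \<zeta> t x {z. time_slope \<le> \<zeta> \<bullet> z}"
  proof (rule has_time_deriv_squeeze[where lo = lower_bound and up = upper_bound])
    show "\<zeta> \<noteq> 0" "t \<le> T" using \<zeta>_nonzero t_less by simp_all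
    show "upper_bound t \<le> lower_bound t" unfolding upper_bound_t lower_bound_t ..
  qed (fact value_fun_ge_lower_bound value_fun_attains_upper_bound
      lower_bound_quotient_LIMSEQ upper_bound_quotient_LIMSEQ)+
  then show ?thesis
    unfolding Y_T stationary[symmetric] fenchel_conj_running_cost translate_halfspace time_slope_eq .
qed

end

section \<open>The evolution equation\<close>

lemma strictly_convex_scale:
  fixes f :: "'a::real_vector \<Rightarrow> real"
  assumes "strictly_convex f" "0 < c"
  shows "strictly_convex (\<lambda>w. c * f w)"
  unfolding strictly_convex_def
proof (intro allI impI)
  fix x y :: 'a and u :: real assume "x \<noteq> y \<and> 0 < u \<and> u < 1"
  then have "f ((1 - u) *\<^sub>R x + u *\<^sub>R y) < (1 - u) * f x + u * f y"
    using assms(1) unfolding strictly_convex_def by blast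
  from mult_strict_left_mono[OF this assms(2)]
  show "c * f ((1 - u) *\<^sub>R x + u *\<^sub>R y) < (1 - u) * (c * f x) + u * (c * f y)"
    by (simp add: algebra_simps)
qed

lemma coercive_scale:
  assumes "coercive f" "0 < c"
  shows "coercive (\<lambda>w. c * f w)"
  using filterlim_tendsto_pos_mult_at_top[OF tendsto_const[of c] assms(2) assms(1)[unfolded coercive_def]]
  by (simp add: coercive_def)

theorem theorem6p5:
  fixes C B :: "(real ^ 'd) set"
    and L g :: "real ^ 'n \<Rightarrow> real ^ 'd"
    and d d' :: "real \<Rightarrow> real \<Rightarrow> real"
    and T a t :: real
    and x p :: "real ^ 'n"
    and \<zeta> :: "real ^ 'd"
  assumes C: "closed C" "convex C" "cone C" "interior C \<noteq> {}"
    and base: "is_base B (dual_cone C)"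
    and T: "0 < T"
    and h1: "\<forall>\<xi>\<in>B. C2 (\<lambda>w. L w \<bullet> \<xi>) \<and> strictly_convex (\<lambda>w. L w \<bullet> \<xi>) \<and> coercive (\<lambda>w. L w \<bullet> \<xi>)"
    and h2: "\<forall>\<xi>\<in>B. \<exists>K. K-lipschitz_on UNIV (\<lambda>w. g w \<bullet> \<xi>)"
    and h3: "0 < a"
      "\<forall>\<tau>\<in>{0..T}. d \<tau> ` {\<tau>..T} \<subseteq> {a<..1} \<and> continuous_on {\<tau>..T} (d \<tau>) \<and> d \<tau> \<tau> = 1"
    and h4: "\<forall>s\<in>{0..T}. \<forall>\<tau>\<in>{0..s}. ((\<lambda>\<tau>. d \<tau> s) has_real_derivative d' \<tau> s) (at \<tau> within {0..s})"
      "continuous_on {(\<tau>, s). 0 \<le> \<tau> \<and> \<tau> \<le> s \<and> s \<le> T} (\<lambda>(\<tau>, s). d' \<tau> s)"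
    and h5: "\<forall>\<xi>\<in>B. C2 (\<lambda>w. g w \<bullet> \<xi>) \<and> convex_on UNIV (\<lambda>w. g w \<bullet> \<xi>)"
    and \<zeta>: "\<zeta> \<in> dual_cone C - {0}"
    and t: "t \<in> {0..<T}"
    and well_defined: "\<forall>q. set_integrable lebesgue {t..T}
      (\<lambda>s. d t s *\<^sub>R L (weak_deriv t T (Y_path L d t x q \<zeta>) s))"
    and p: "\<forall>q. I_scal L g d T t \<zeta> (Y_path L d t x p \<zeta>) \<le> I_scal L g d T t \<zeta> (Y_path L d t x q \<zeta>)"
  shows "has_time_deriv (value_fun C L g d T) T \<zeta> t x
     ((+) (w_fun L g d' T t (Y_path L d t x p \<zeta>)) `
        fenchel_conj (running_cost C L d t t)
          (- (d t T *\<^sub>R grad (\<lambda>w. g w \<bullet> \<zeta>) (Y_path L d t x p \<zeta> T))) \<zeta>)"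
proof -
  \<comment> \<open>Scaling by \<open>c\<close> carries the hypotheses from the base to all of \<open>C\<^sup>+ - {0}\<close>.\<close>
  obtain c \<xi> where \<xi>: "0 < c" "\<xi> \<in> B" "\<zeta> = c *\<^sub>R \<xi>"
    using base \<zeta> unfolding is_base_def by (metis fst_conv snd_conv)
  have scale: "(\<lambda>w. F w \<bullet> \<zeta>) = (\<lambda>w. c * (F w \<bullet> \<xi>))" for F :: "real ^ 'n \<Rightarrow> real ^ 'd"
    by (simp add: \<xi>(3))
  obtain K where K: "K-lipschitz_on UNIV (\<lambda>w. g w \<bullet> \<xi>)" using h2 \<xi>(2) by blast
  have "interior C \<subseteq> C" by (rule interior_subset)
  then have "C \<noteq> {}" using C(4) by blast
  then have "0 \<in> C" using C(3) by (simp add: cone_contains_0)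
  interpret set_valued_optimum L g \<zeta> d d' T a t x C p
  proof unfold_locales
    show "C2 (\<lambda>w. L w \<bullet> \<zeta>)" "strictly_convex (\<lambda>w. L w \<bullet> \<zeta>)" "coercive (\<lambda>w. L w \<bullet> \<zeta>)"
      "C2 (\<lambda>w. g w \<bullet> \<zeta>)"
      unfolding scale using h1 h5 \<xi>(1,2)
      by (simp_all add: C2_scale strictly_convex_scale coercive_scale)
    show "convex_on UNIV (\<lambda>w. g w \<bullet> \<zeta>)"
      unfolding scale using h5 \<xi>(1,2) by (intro convex_on_cmul) auto
    show "\<exists>K. K-lipschitz_on UNIV (\<lambda>w. g w \<bullet> \<zeta>)"
      unfolding scale using lipschitz_on_cmult_real[OF K, of c] by auto
    show "((\<lambda>\<tau>. d \<tau> s) has_real_derivative d' \<tau> s) (at \<tau> within {t..s})"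
      if "t \<le> \<tau>" "\<tau> \<le> s" "s \<le> T" for \<tau> s
      using h4(1) that t by (intro DERIV_subset[of _ _ _ "{0..s}" "{t..s}"]) auto
    show "continuous_on {(\<tau>, s). t \<le> \<tau> \<and> \<tau> \<le> s \<and> s \<le> T} (\<lambda>(\<tau>, s). d' \<tau> s)"
      by (rule continuous_on_subset[OF h4(2)]) (use t in auto)
  qed (use \<open>0 \<in> C\<close> h3 t \<zeta> well_defined p in auto)
  show ?thesis by (rule value_fun_has_time_deriv)
qed

end
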